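(* Let $\mathcal{R}$ be a Borel equivalence relation with countable classes on a standard Borel space $X$, let $\mathcal{A}$ be an $\mathcal{R}$-arboretum on $X$, and let a desingularization of the action of $\mathcal{R}$ on $\mathcal{A}$ be given, with graph of relations $G^r$ (underlying oriented graph $G$), rooted maximal subtree $A_m$, representation $\chi$ and partial isomorphisms $\phi_a$. Let $\mathcal{R}''$ be the sub-relation of $\mathcal{R}$ generated by the partial isomorphisms $\phi_a$ carried by the edges $a$ of $G$. Then: 1. every relation $\mathcal{R}_P$ carried by a vertex $P$ of $G$ (identified via $\chi$ with a sub-relation of $\mathcal{R}$ on a Borel subset of $X$) has trivial intersection with $\mathcal{R}''$; 2. $\mathcal{R}''$ is arborable (treeable).
   Context: Fibred spaces and actions. A fibred standard space over $X$ is a standard Borel space $F$ with a surjective Borel map $\pi:F\to X$ with countable preimages; $F_x=\pi^{-1}(x)$. An $\mathcal{R}$-action on $F$ (then $F$ is an $\mathcal{R}$-fibred standard space) is a Borel map assigning to $(x,y)\in\mathcal{R}$ and $f\in F_y$ an element $(x,y)\cdot f\in F_x$, with $(y,y)\cdot f=f$ and $(x,y)\cdot((y,z)\cdot f)=(x,z)\cdot f$. $\mathcal{R}_F$ is the orbit equivalence relation on $F$: $f_x\in F_x$, $f_y\in F_y$ are equivalent iff $(x,y)\in\mathcal{R}$ and $(x,y)\cdot f_y=f_x$. Morphisms are equivariant fibre-preserving Borel maps. A partial section is a Borel map $s:B\to F$, $B\subset X$ Borel, with $\pi\circ s=\mathrm{id}_B$; $\mathrm{Stab}_{\mathcal{R}}(s)$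 is the sub-relation of $\mathcal{R}$ on $B$: $x\sim y$ iff $(x,y)\in\mathcal R$ and $(y,x)\cdot s(x)=s(y)$. $[[\mathcal{R}]]$ is the set of Borel isomorphisms between Borel subsets of $X$ with graph contained in $\mathcal{R}$. A fundamental domain of a Borel equivalence relation is a Borel set meeting each class in exactly one point. A Borel equivalence relation with countable classes on a standard Borel space $Z$ is arborable (treeable) if there is a symmetric Borel subset of $Z\times Z$ disjoint from the diagonal which, as a graph on $Z$, is acyclic and has the classes as connected components. Arboretums. Graphs are in the sense of Serre (edges $a$ with origin $o(a)$, terminal vertex $t(a)$, opposite edge $\bar a\ne a$). A Borel $\mathcal{R}$-field of graphs $\mathcal{A}$ on $X$ is a graph whose vertex space $\mathcal{A}^0$ and edge space $\mathcal{A}^1$ are $\mathcal{R}$-fibred standard spaces and for which $o,t,\bar{\ }$ are morphisms; it is an $\mathcal{R}$-arboretum if each fibre $\mathcal{A}_x$ is a tree. An arboretum (without $\mathcal{R}$) is the same notion for the trivial relation; a sub-arboretum of the restriction $\mathcal{A}|_Y$ to a Borel $Y\subset X$ is a Borel subgraph, all of whose fibres over $Y$ are trees (no invariance required). Graphs of relations. A graph of relations $G^r$ consists of a countable graph $G$, a Borel equivalence relation $\mathcal{R}_P$ on a standard Borel space $X_P$ for each vertex $P$, a Borel equivalence relation $\mathcal{R}_a$ on a standard Borel space $X_a$ for each edge $a$ with $\mathcal{R}_a=\mathcal{R}_{\bar a}$ (and $X_a=X_{\bar a}$), and for each edge $a$ an injective morphism from $\mathcal{R}_a$ to $\mathcal{R}_{t(a)}$,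 i.e. an injective Borel map $j_a:X_a\to X_{t(a)}$ sending equivalent points to equivalent points. Each edge $a$ thus carries the partial isomorphism $j_a\circ j_{\bar a}^{-1}$ from a Borel subset of $X_{o(a)}$ to a Borel subset of $X_{t(a)}$. If $G$ is a tree (tree of relations), these partial isomorphisms generate a Borel equivalence relation on $\bigsqcup_P X_P$; $G^r$ is rooted at a vertex $P_0$ (the root) if $X_{P_0}$ is a fundamental domain of this relation. A rooted tree of relations defines an arboretum on $X_{P_0}$, with vertex space $\bigsqcup_PX_P$, edge space $\bigsqcup_aX_a$, the endpoints of a point $u\in X_a$ being $j_{\bar a}(u)\in X_{o(a)}$ and $j_a(u)\in X_{t(a)}$, and projection sending a vertex to the unique equivalent point of $X_{P_0}$. Representation. A representation of a rooted tree of relations $G^r$ in $\mathcal{A}$ is a Borel isomorphism of $X_{P_0}$ onto a Borel subset $Y\subset X$ and, over it, an isomorphism $\chi$ from the arboretum defined by $G^r$ onto a sub-arboretum of $\mathcal{A}|_Y$, such that $\chi$ induces isomorphisms of $\mathcal{R}_P$ onto $\mathcal{R}_{\mathcal{A}^0}|_{\chi(X_P)}$ for each vertex $P$ and of $\mathcal{R}_a$ onto $\mathcal{R}_{\mathcal{A}^1}|_{\chi(X_a)}$ for each edge $a$. The sets $\chi(X_P),\chi(X_a)$ are called the representations of $X_P,X_a$. An arboretum of representatives of the action is a rooted tree of relations with a representation $\chi$ in $\mathcal{A}$ such that the $\mathcal{R}_{\mathcal{A}^0}$-saturations of the $\chi(X_P)$ form a partition of $\mathcal{A}^0$. Via $\pi\circ\chi$,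 $X_P$ is identified with a Borel subset of $X$ and $\mathcal{R}_P$ with a sub-relation of $\mathcal{R}$ on it. Desingularization. A desingularization of the action of $\mathcal{R}$ on $\mathcal{A}$ consists of a graph of relations $G^r$ whose underlying graph $G$ is oriented, a rooted maximal subtree $A_m$ of $G$, and for each edge $a$ of the orientation not in $A_m$ an element $\phi_a\in[[\mathcal{R}]]$, such that: (1) the rooted tree of relations induced by $G^r$ on $A_m$, with a representation $\chi$, is an arboretum of representatives for which the space carried by the root is identified with $X$ (i.e. $Y=X$); (2) for each edge $a$ of the orientation not in $A_m$ there is a partial section of edges $s_a$ defined on the source of $\phi_a$ such that $o(s_a(x))\in\chi(X_{o(a)})$ and $(\phi_a(x),x)\cdot t(s_a(x))\in\chi(X_{t(a)})$ for all $x$; the image of $s_a$ is called a representation of $X_a$ (and the set of opposite edges a representation of $X_{\bar a}$); (3) for each such $a$, $\chi$ induces an isomorphism between $\mathrm{Stab}_{\mathcal{R}}(s_a)$, viewed as a sub-relation of the representation of $\mathcal{R}_{o(a)}$, and the image of $\mathcal{R}_{\bar a}$ in $\mathcal{R}_{t(\bar a)}=\mathcal{R}_{o(a)}$ by the injective morphism associated with $\bar a$; and an isomorphism between $\phi_a\mathrm{Stab}_{\mathcal{R}}(s_a)\phi_a^{-1}$ (the relation transported by $\phi_a$ to its range), viewed as a sub-relation of the representation of $\mathcal{R}_{t(a)}$, and the image of $\mathcal{R}_a$ in $\mathcal{R}_{t(a)}$ by the injective morphism associated with $a$; (4) the $\mathcal{R}_{\mathcal{A}^1}$-saturations of the representations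 of the spaces carried by the edges of $G^r$ (one set for each edge, $a$ and $\bar a$ being distinct edges) form a partition of $\mathcal{A}^1$. Conventions: $\phi_{\bar a}=\phi_a^{-1}$ for $a$ in the orientation and not in $A_m$; for an edge $a$ of $A_m$, $\phi_a$ is the restriction of the identity of $X$ to the projection in $X$ of the representation of $X_{o(a)}$. A relation is trivial if equivalent points are equal. *)

theory Defs
  imports "HOL-Analysis.Analysis"
begin

(* Measurable spaces are modelled by the type "measure"; the measure itself plays no role
   anywhere, only space and sets do. *)

definition standard_borel :: "'a measure \<Rightarrow> bool" where
  "standard_borel M \<longleftrightarrow>
     (\<exists>T. completely_metrizable_space T \<and> second_countable T \<and>
          topspace T = space M \<and> sets M = sigma_sets (topspace T) {U. openin T U})"

definition borel_iso :: "'a measure \<Rightarrow> 'b measure \<Rightarrow> ('a \<Rightarrow> 'b) \<Rightarrow> bool" where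
  "borel_iso M N f \<longleftrightarrow>
     f \<in> M \<rightarrow>\<^sub>M N \<and> bij_betw f (space M) (space N) \<and> the_inv_into (space M) f \<in> N \<rightarrow>\<^sub>M M"

(* Disjoint union of the spaces M i, i in I; measurability is checked on each summand. *)
definition coprod_space :: "'i set \<Rightarrow> ('i \<Rightarrow> 'a measure) \<Rightarrow> ('i \<times> 'a) measure" where
  "coprod_space I M =
     sigma (SIGMA i:I. space (M i))
       {A. A \<subseteq> (SIGMA i:I. space (M i)) \<and> (\<forall>i\<in>I. {u. (i, u) \<in> A} \<in> sets (M i))}"

lemma space_coprod_space: "space (coprod_space I M) = (SIGMA i:I. space (M i))"
  unfolding coprod_space_def by (rule space_measure_of) auto

lemma sets_coprod_space:
  "sets (coprod_space I M) =
     {A. A \<subseteq> (SIGMA i:I. space (M i)) \<and> (\<forall>i\<in>I. {u. (i, u) \<in> A} \<in> sets (M i))}"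
  (is "_ = ?S")
proof -
  have "sigma_algebra (SIGMA i:I. space (M i)) ?S"
    unfolding sigma_algebra_iff2
  proof (intro conjI ballI allI impI)
    show "?S \<subseteq> Pow (SIGMA i:I. space (M i))" by auto
    show "{} \<in> ?S" by auto
  next
    fix A assume A: "A \<in> ?S"
    have "{u. (i, u) \<in> (SIGMA i:I. space (M i)) - A} \<in> sets (M i)" if "i \<in> I" for i
    proof -
      have "{u. (i, u) \<in> (SIGMA i:I. space (M i)) - A} = space (M i) - {u. (i, u) \<in> A}"
        using that by auto
      then show ?thesis using A that by auto
    qed
    then show "(SIGMA i:I. space (M i)) - A \<in> ?S" by auto
  next
    fix A :: "nat \<Rightarrow> _" assume A: "range A \<subseteq> ?S"
    have "{u. (i, u) \<in> (\<Union>n. A n)} \<in> sets (M i)" if "i \<in> I" for i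
    proof -
      have "{u. (i, u) \<in> (\<Union>n. A n)} = (\<Union>n. {u. (i, u) \<in> A n})" by auto
      also have "\<dots> \<in> sets (M i)"
        using A that by (intro sets.countable_UN) blast
      finally show ?thesis .
    qed
    then show "(\<Union>n. A n) \<in> ?S" using A by blast
  qed
  then show ?thesis
    unfolding coprod_space_def by (simp add: sigma_algebra.sets_measure_of_eq)
qed

definition borel_equiv :: "'a measure \<Rightarrow> ('a \<times> 'a) set \<Rightarrow> bool" where
  "borel_equiv M Q \<longleftrightarrow> Q \<in> sets (M \<Otimes>\<^sub>M M) \<and> equiv (space M) Q"

definition countable_borel_equiv :: "'a measure \<Rightarrow> ('a \<times> 'a) set \<Rightarrow> bool" where
  "countable_borel_equiv M Q \<longleftrightarrow> borel_equiv M Q \<and> (\<forall>x\<in>space M. countable (Q `` {x}))"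

definition generated_equiv :: "'a set \<Rightarrow> ('a \<times> 'a) set \<Rightarrow> ('a \<times> 'a) set" where
  "generated_equiv S E = \<Inter>{Q. equiv S Q \<and> E \<subseteq> Q}"

definition fundamental_domain :: "'a measure \<Rightarrow> ('a \<times> 'a) set \<Rightarrow> 'a set \<Rightarrow> bool" where
  "fundamental_domain M Q D \<longleftrightarrow> D \<in> sets M \<and> (\<forall>C \<in> space M // Q. \<exists>!z. z \<in> C \<inter> D)"

definition rel_image :: "('a \<Rightarrow> 'b) \<Rightarrow> ('a \<times> 'a) set \<Rightarrow> ('b \<times> 'b) set" where
  "rel_image f Q = map_prod f f ` Q"

definition trivial_rel :: "('a \<times> 'a) set \<Rightarrow> bool" where
  "trivial_rel Q \<longleftrightarrow> (\<forall>(x, y) \<in> Q. x = y)"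

definition acyclic_graph_rel :: "('a \<times> 'a) set \<Rightarrow> bool" where
  "acyclic_graph_rel E \<longleftrightarrow>
     \<not> (\<exists>p. 3 \<le> length p \<and> distinct p \<and>
            (\<forall>i<length p. (p ! i, p ! (Suc i mod length p)) \<in> E))"

definition arborable :: "'a measure \<Rightarrow> ('a \<times> 'a) set \<Rightarrow> bool" where
  "arborable M Q \<longleftrightarrow> countable_borel_equiv M Q \<and>
     (\<exists>E \<in> sets (M \<Otimes>\<^sub>M M). sym E \<and> irrefl E \<and> acyclic_graph_rel E \<and>
        (\<forall>x\<in>space M. E\<^sup>* `` {x} = Q `` {x}))"

definition full_pseudogroup :: "'x measure \<Rightarrow> ('x \<times> 'x) set \<Rightarrow> ('x \<rightharpoonup> 'x) set" where
  "full_pseudogroup X R =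
     {\<phi>. dom \<phi> \<in> sets X \<and> ran \<phi> \<in> sets X \<and>
         borel_iso (restrict_space X (dom \<phi>)) (restrict_space X (ran \<phi>)) (\<lambda>x. the (\<phi> x)) \<and>
         Map.graph \<phi> \<subseteq> R}"

definition inv_map :: "('x \<rightharpoonup> 'y) \<Rightarrow> ('y \<rightharpoonup> 'x)" where
  "inv_map \<phi> = (\<lambda>y. if y \<in> ran \<phi> then Some (THE x. \<phi> x = Some y) else None)"


(* Graphs in the sense of Serre: a geometric edge is a pair a, opp a of distinct edges. The trees of
   the AFP entry Graph_Theory do not fit, since there the walk a, opp a is a cycle. *)

record ('v, 'e) sgraph =
  verts :: "'v set"
  edges :: "'e set"
  origin :: "'e \<Rightarrow> 'v"
  terminus :: "'e \<Rightarrow> 'v"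
  opp :: "'e \<Rightarrow> 'e"

definition serre_graph :: "('v, 'e) sgraph \<Rightarrow> bool" where
  "serre_graph G \<longleftrightarrow>
     (\<forall>a\<in>edges G. origin G a \<in> verts G \<and> terminus G a \<in> verts G \<and> opp G a \<in> edges G \<and>
        opp G a \<noteq> a \<and> opp G (opp G a) = a \<and>
        origin G (opp G a) = terminus G a \<and> terminus G (opp G a) = origin G a)"

definition connected_graph :: "('v, 'e) sgraph \<Rightarrow> bool" where
  "connected_graph G \<longleftrightarrow> verts G \<noteq> {} \<and>
     (\<forall>u\<in>verts G. \<forall>v\<in>verts G. (u, v) \<in> ((\<lambda>a. (origin G a, terminus G a)) ` edges G)\<^sup>*)"

(* An injective image of the circular graph with n = length p >= 1 vertices;
   for n = 1 this is a loop, for n = 2 a pair of parallel edges. *)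
definition circuit :: "('v, 'e) sgraph \<Rightarrow> 'e list \<Rightarrow> bool" where
  "circuit G p \<longleftrightarrow> p \<noteq> [] \<and> set p \<subseteq> edges G \<and> distinct (map (origin G) p) \<and>
     (\<forall>i<length p. terminus G (p ! i) = origin G (p ! (Suc i mod length p)) \<and>
        p ! (Suc i mod length p) \<noteq> opp G (p ! i))"

definition is_tree :: "('v, 'e) sgraph \<Rightarrow> bool" where
  "is_tree G \<longleftrightarrow> serre_graph G \<and> connected_graph G \<and> \<not> (\<exists>p. circuit G p)"

definition subgraph :: "('v, 'e) sgraph \<Rightarrow> ('v, 'e) sgraph \<Rightarrow> bool" where
  "subgraph H G \<longleftrightarrow> serre_graph H \<and> verts H \<subseteq> verts G \<and> edges H \<subseteq> edges G \<and>
     (\<forall>a\<in>edges H. origin H a = origin G a \<and> terminus H a = terminus G a \<and> opp H a = opp G a)"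

definition maximal_subtree :: "('v, 'e) sgraph \<Rightarrow> ('v, 'e) sgraph \<Rightarrow> bool" where
  "maximal_subtree T G \<longleftrightarrow> subgraph T G \<and> is_tree T \<and>
     (\<forall>T'. subgraph T' G \<and> is_tree T' \<and> subgraph T T' \<longrightarrow>
           verts T' = verts T \<and> edges T' = edges T)"

definition orientation :: "('v, 'e) sgraph \<Rightarrow> 'e set \<Rightarrow> bool" where
  "orientation G Or \<longleftrightarrow> Or \<subseteq> edges G \<and> (\<forall>a\<in>edges G. a \<in> Or \<longleftrightarrow> opp G a \<notin> Or)"


record ('x, 'f) fibred_space =
  tot :: "'f measure"
  prj :: "'f \<Rightarrow> 'x"

definition fibre :: "('x, 'f) fibred_space \<Rightarrow> 'x \<Rightarrow> 'f set" where
  "fibre F x = {f \<in> space (tot F). prj F f = x}"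

definition fibred_standard :: "'x measure \<Rightarrow> ('x, 'f) fibred_space \<Rightarrow> bool" where
  "fibred_standard X F \<longleftrightarrow> standard_borel (tot F) \<and> prj F \<in> tot F \<rightarrow>\<^sub>M X \<and>
     prj F ` space (tot F) = space X \<and> (\<forall>x\<in>space X. countable (fibre F x))"

(* \<alpha> x y f stands for (x,y).f, where (x,y) is in R and f lies over y *)
definition borel_action ::
  "'x measure \<Rightarrow> ('x \<times> 'x) set \<Rightarrow> ('x, 'f) fibred_space \<Rightarrow> ('x \<Rightarrow> 'x \<Rightarrow> 'f \<Rightarrow> 'f) \<Rightarrow> bool" where
  "borel_action X R F \<alpha> \<longleftrightarrow>
     (\<lambda>((x, y), f). \<alpha> x y f) \<in>
        restrict_space ((X \<Otimes>\<^sub>M X) \<Otimes>\<^sub>M tot F) {((x, y), f). (x, y) \<in> R \<and> f \<in> fibre F y} \<rightarrow>\<^sub>M tot F \<and>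
     (\<forall>(x, y)\<in>R. \<forall>f\<in>fibre F y. \<alpha> x y f \<in> fibre F x) \<and>
     (\<forall>y\<in>space X. \<forall>f\<in>fibre F y. \<alpha> y y f = f) \<and>
     (\<forall>x y z. \<forall>f\<in>fibre F z. (x, y) \<in> R \<and> (y, z) \<in> R \<longrightarrow> \<alpha> x y (\<alpha> y z f) = \<alpha> x z f)"

definition orbit_rel ::
  "('x \<times> 'x) set \<Rightarrow> ('x, 'f) fibred_space \<Rightarrow> ('x \<Rightarrow> 'x \<Rightarrow> 'f \<Rightarrow> 'f) \<Rightarrow> ('f \<times> 'f) set" where
  "orbit_rel R F \<alpha> = {(f, g). f \<in> space (tot F) \<and> g \<in> space (tot F) \<and>
     (prj F f, prj F g) \<in> R \<and> \<alpha> (prj F f) (prj F g) g = f}"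

definition fibred_morphism ::
  "('x \<times> 'x) set \<Rightarrow> ('x, 'f) fibred_space \<Rightarrow> ('x \<Rightarrow> 'x \<Rightarrow> 'f \<Rightarrow> 'f) \<Rightarrow>
     ('x, 'g) fibred_space \<Rightarrow> ('x \<Rightarrow> 'x \<Rightarrow> 'g \<Rightarrow> 'g) \<Rightarrow> ('f \<Rightarrow> 'g) \<Rightarrow> bool" where
  "fibred_morphism R F \<alpha> F' \<alpha>' h \<longleftrightarrow> h \<in> tot F \<rightarrow>\<^sub>M tot F' \<and>
     (\<forall>f\<in>space (tot F). prj F' (h f) = prj F f) \<and>
     (\<forall>(x, y)\<in>R. \<forall>f\<in>fibre F y. h (\<alpha> x y f) = \<alpha>' x y (h f))"

definition partial_section ::
  "'x measure \<Rightarrow> ('x, 'f) fibred_space \<Rightarrow> 'x set \<Rightarrow> ('x \<Rightarrow> 'f) \<Rightarrow> bool" where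
  "partial_section X F B s \<longleftrightarrow> B \<in> sets X \<and> s \<in> restrict_space X B \<rightarrow>\<^sub>M tot F \<and>
     (\<forall>x\<in>B. prj F (s x) = x)"

definition stab ::
  "('x \<times> 'x) set \<Rightarrow> ('x \<Rightarrow> 'x \<Rightarrow> 'f \<Rightarrow> 'f) \<Rightarrow> 'x set \<Rightarrow> ('x \<Rightarrow> 'f) \<Rightarrow> ('x \<times> 'x) set" where
  "stab R \<alpha> B s = {(x, y). x \<in> B \<and> y \<in> B \<and> (x, y) \<in> R \<and> \<alpha> y x (s x) = s y}"


record ('x, 'v, 'e) graph_field =
  vsp :: "('x, 'v) fibred_space"
  esp :: "('x, 'e) fibred_space"
  forg :: "'e \<Rightarrow> 'v"
  fter :: "'e \<Rightarrow> 'v"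
  fopp :: "'e \<Rightarrow> 'e"

record ('x, 'v, 'e) graph_field_act = "('x, 'v, 'e) graph_field" +
  vact :: "'x \<Rightarrow> 'x \<Rightarrow> 'v \<Rightarrow> 'v"
  eact :: "'x \<Rightarrow> 'x \<Rightarrow> 'e \<Rightarrow> 'e"

definition total_graph :: "('x, 'v, 'e, 'z) graph_field_scheme \<Rightarrow> ('v, 'e) sgraph" where
  "total_graph A = \<lparr>verts = space (tot (vsp A)), edges = space (tot (esp A)),
     origin = forg A, terminus = fter A, opp = fopp A\<rparr>"

definition fibre_graph :: "('x, 'v, 'e, 'z) graph_field_scheme \<Rightarrow> 'x \<Rightarrow> ('v, 'e) sgraph" where
  "fibre_graph A x = \<lparr>verts = fibre (vsp A) x, edges = fibre (esp A) x,
     origin = forg A, terminus = fter A, opp = fopp A\<rparr>"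

definition borel_graph_field ::
  "'x measure \<Rightarrow> ('x \<times> 'x) set \<Rightarrow> ('x, 'v, 'e) graph_field_act \<Rightarrow> bool" where
  "borel_graph_field X R A \<longleftrightarrow>
     fibred_standard X (vsp A) \<and> borel_action X R (vsp A) (vact A) \<and>
     fibred_standard X (esp A) \<and> borel_action X R (esp A) (eact A) \<and>
     serre_graph (total_graph A) \<and>
     fibred_morphism R (esp A) (eact A) (vsp A) (vact A) (forg A) \<and>
     fibred_morphism R (esp A) (eact A) (vsp A) (vact A) (fter A) \<and>
     fibred_morphism R (esp A) (eact A) (esp A) (eact A) (fopp A)"

definition arboretum ::
  "'x measure \<Rightarrow> ('x \<times> 'x) set \<Rightarrow> ('x, 'v, 'e) graph_field_act \<Rightarrow> bool" where
  "arboretum X R A \<longleftrightarrow> borel_graph_field X R A \<and> (\<forall>x\<in>space X. is_tree (fibre_graph A x))"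

abbreviation vorbit :: "('x \<times> 'x) set \<Rightarrow> ('x, 'v, 'e) graph_field_act \<Rightarrow> ('v \<times> 'v) set" where
  "vorbit R A \<equiv> orbit_rel R (vsp A) (vact A)"

abbreviation eorbit :: "('x \<times> 'x) set \<Rightarrow> ('x, 'v, 'e) graph_field_act \<Rightarrow> ('e \<times> 'e) set" where
  "eorbit R A \<equiv> orbit_rel R (esp A) (eact A)"

definition subfield ::
  "('x, 'v, 'e, 'z) graph_field_scheme \<Rightarrow> 'v set \<Rightarrow> 'e set \<Rightarrow> ('x, 'v, 'e, 'z) graph_field_scheme"
where
  "subfield A V E =
     A\<lparr>vsp := (vsp A)\<lparr>tot := restrict_space (tot (vsp A)) V\<rparr>,
       esp := (esp A)\<lparr>tot := restrict_space (tot (esp A)) E\<rparr>\<rparr>"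

(* that V, E are closed under origin, terminus and opposite is part of the fibres being trees *)
definition sub_arboretum ::
  "('x, 'v, 'e, 'z) graph_field_scheme \<Rightarrow> 'x set \<Rightarrow> 'v set \<Rightarrow> 'e set \<Rightarrow> bool" where
  "sub_arboretum A Y V E \<longleftrightarrow>
     V \<in> sets (tot (vsp A)) \<and> E \<in> sets (tot (esp A)) \<and>
     prj (vsp A) ` V \<subseteq> Y \<and> prj (esp A) ` E \<subseteq> Y \<and>
     (\<forall>y\<in>Y. is_tree (fibre_graph (subfield A V E) y))"

definition graph_field_iso ::
  "('y, 'v1, 'e1, 'z1) graph_field_scheme \<Rightarrow> ('x, 'v2, 'e2, 'z2) graph_field_scheme \<Rightarrow>
     ('y \<Rightarrow> 'x) \<Rightarrow> ('v1 \<Rightarrow> 'v2) \<Rightarrow> ('e1 \<Rightarrow> 'e2) \<Rightarrow> bool" where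
  "graph_field_iso B A \<theta> hV hE \<longleftrightarrow>
     borel_iso (tot (vsp B)) (tot (vsp A)) hV \<and>
     borel_iso (tot (esp B)) (tot (esp A)) hE \<and>
     (\<forall>z\<in>space (tot (vsp B)). prj (vsp A) (hV z) = \<theta> (prj (vsp B) z)) \<and>
     (\<forall>z\<in>space (tot (esp B)). prj (esp A) (hE z) = \<theta> (prj (esp B) z) \<and>
        forg A (hE z) = hV (forg B z) \<and> fter A (hE z) = hV (fter B z) \<and>
        fopp A (hE z) = hE (fopp B z))"


(* The carried spaces of all vertices (resp. edges) share one type; for countably many
   standard Borel spaces this is no restriction. *)
record ('p, 'a, 'u, 'w) rel_graph =
  ugraph :: "('p, 'a) sgraph"
  vspace :: "'p \<Rightarrow> 'u measure"
  vrel :: "'p \<Rightarrow> ('u \<times> 'u) set"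
  espace :: "'a \<Rightarrow> 'w measure"
  erel :: "'a \<Rightarrow> ('w \<times> 'w) set"
  inj_mor :: "'a \<Rightarrow> 'w \<Rightarrow> 'u"

definition graph_of_relations :: "('p, 'a, 'u, 'w) rel_graph \<Rightarrow> bool" where
  "graph_of_relations H \<longleftrightarrow> (let G = ugraph H in
     serre_graph G \<and> countable (verts G) \<and> countable (edges G) \<and>
     (\<forall>P\<in>verts G. standard_borel (vspace H P) \<and> borel_equiv (vspace H P) (vrel H P)) \<and>
     (\<forall>a\<in>edges G. standard_borel (espace H a) \<and> borel_equiv (espace H a) (erel H a) \<and>
        sets (espace H (opp G a)) = sets (espace H a) \<and> erel H (opp G a) = erel H a \<and>
        inj_mor H a \<in> espace H a \<rightarrow>\<^sub>M vspace H (terminus G a) \<and>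
        inj_on (inj_mor H a) (space (espace H a)) \<and>
        (\<forall>(u, v)\<in>erel H a. (inj_mor H a u, inj_mor H a v) \<in> vrel H (terminus G a))))"

definition vtotal :: "('p, 'a, 'u, 'w) rel_graph \<Rightarrow> ('p \<times> 'u) measure" where
  "vtotal H = coprod_space (verts (ugraph H)) (vspace H)"

definition etotal :: "('p, 'a, 'u, 'w) rel_graph \<Rightarrow> ('a \<times> 'w) measure" where
  "etotal H = coprod_space (edges (ugraph H)) (espace H)"

definition torigin :: "('p, 'a, 'u, 'w) rel_graph \<Rightarrow> 'a \<times> 'w \<Rightarrow> 'p \<times> 'u" where
  "torigin H = (\<lambda>(a, u). (origin (ugraph H) a, inj_mor H (opp (ugraph H) a) u))"

definition tterminus :: "('p, 'a, 'u, 'w) rel_graph \<Rightarrow> 'a \<times> 'w \<Rightarrow> 'p \<times> 'u" where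
  "tterminus H = (\<lambda>(a, u). (terminus (ugraph H) a, inj_mor H a u))"

(* The pairs (torigin z, tterminus z) with z in the summand of a form the graph of the partial
   isomorphism carried by a. *)
definition tree_equiv :: "('p, 'a, 'u, 'w) rel_graph \<Rightarrow> (('p \<times> 'u) \<times> ('p \<times> 'u)) set" where
  "tree_equiv H = generated_equiv (space (vtotal H))
     ((\<lambda>z. (torigin H z, tterminus H z)) ` space (etotal H))"

definition rooted_tree_of_relations :: "('p, 'a, 'u, 'w) rel_graph \<Rightarrow> 'p \<Rightarrow> bool" where
  "rooted_tree_of_relations H P0 \<longleftrightarrow>
     graph_of_relations H \<and> is_tree (ugraph H) \<and> P0 \<in> verts (ugraph H) \<and>
     fundamental_domain (vtotal H) (tree_equiv H) ({P0} \<times> space (vspace H P0))"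

definition root_proj :: "('p, 'a, 'u, 'w) rel_graph \<Rightarrow> 'p \<Rightarrow> 'p \<times> 'u \<Rightarrow> 'u" where
  "root_proj H P0 z = (THE u. u \<in> space (vspace H P0) \<and> (z, (P0, u)) \<in> tree_equiv H)"

definition tree_arboretum ::
  "('p, 'a, 'u, 'w) rel_graph \<Rightarrow> 'p \<Rightarrow> ('u, 'p \<times> 'u, 'a \<times> 'w) graph_field" where
  "tree_arboretum H P0 =
     \<lparr>vsp = \<lparr>tot = vtotal H, prj = root_proj H P0\<rparr>,
      esp = \<lparr>tot = etotal H, prj = (\<lambda>z. root_proj H P0 (torigin H z))\<rparr>,
      forg = torigin H, fter = tterminus H,
      fopp = (\<lambda>(a, u). (opp (ugraph H) a, u))\<rparr>"

record ('x, 'v, 'e, 'p, 'a, 'u, 'w) tree_rep =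
  rbase :: "'u \<Rightarrow> 'x"
  rvert :: "'p \<times> 'u \<Rightarrow> 'v"
  redge :: "'a \<times> 'w \<Rightarrow> 'e"

definition vimg :: "('p, 'a, 'u, 'w) rel_graph \<Rightarrow>
    ('x, 'v, 'e, 'p, 'a, 'u, 'w) tree_rep \<Rightarrow> 'p \<Rightarrow> 'v set" where
  "vimg H \<rho> P = (\<lambda>u. rvert \<rho> (P, u)) ` space (vspace H P)"

definition eimg :: "('p, 'a, 'u, 'w) rel_graph \<Rightarrow>
    ('x, 'v, 'e, 'p, 'a, 'u, 'w) tree_rep \<Rightarrow> 'a \<Rightarrow> 'e set" where
  "eimg H \<rho> a = (\<lambda>u. redge \<rho> (a, u)) ` space (espace H a)"

(* the identification of X_P with a subset of X *)
definition ident :: "('x, 'v, 'e) graph_field_act \<Rightarrow>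
    ('x, 'v, 'e, 'p, 'a, 'u, 'w) tree_rep \<Rightarrow> 'p \<Rightarrow> 'u \<Rightarrow> 'x" where
  "ident A \<rho> P u = prj (vsp A) (rvert \<rho> (P, u))"

definition representation ::
  "'x measure \<Rightarrow> ('x \<times> 'x) set \<Rightarrow> ('x, 'v, 'e) graph_field_act \<Rightarrow>
     ('p, 'a, 'u, 'w) rel_graph \<Rightarrow> 'p \<Rightarrow> 'x set \<Rightarrow>
     ('x, 'v, 'e, 'p, 'a, 'u, 'w) tree_rep \<Rightarrow> bool" where
  "representation X R A H P0 Y \<rho> \<longleftrightarrow>
     Y \<in> sets X \<and>
     borel_iso (vspace H P0) (restrict_space X Y) (rbase \<rho>) \<and>
     (let V = rvert \<rho> ` space (vtotal H); E = redge \<rho> ` space (etotal H) in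
        sub_arboretum A Y V E \<and>
        graph_field_iso (tree_arboretum H P0) (subfield A V E) (rbase \<rho>) (rvert \<rho>) (redge \<rho>)) \<and>
     (\<forall>P\<in>verts (ugraph H).
        rel_image (\<lambda>u. rvert \<rho> (P, u)) (vrel H P) = Restr (vorbit R A) (vimg H \<rho> P)) \<and>
     (\<forall>a\<in>edges (ugraph H).
        rel_image (\<lambda>u. redge \<rho> (a, u)) (erel H a) = Restr (eorbit R A) (eimg H \<rho> a))"

(* partition into pieces indexed by I, empty pieces being allowed *)
definition indexed_partition :: "'i set \<Rightarrow> ('i \<Rightarrow> 'a set) \<Rightarrow> 'a set \<Rightarrow> bool" where
  "indexed_partition I S Z \<longleftrightarrow> disjoint_family_on S I \<and> (\<Union>i\<in>I. S i) = Z"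

definition arboretum_of_representatives ::
  "'x measure \<Rightarrow> ('x \<times> 'x) set \<Rightarrow> ('x, 'v, 'e) graph_field_act \<Rightarrow>
     ('p, 'a, 'u, 'w) rel_graph \<Rightarrow> 'p \<Rightarrow> 'x set \<Rightarrow>
     ('x, 'v, 'e, 'p, 'a, 'u, 'w) tree_rep \<Rightarrow> bool" where
  "arboretum_of_representatives X R A H P0 Y \<rho> \<longleftrightarrow>
     rooted_tree_of_relations H P0 \<and> representation X R A H P0 Y \<rho> \<and>
     indexed_partition (verts (ugraph H)) (\<lambda>P. vorbit R A `` vimg H \<rho> P) (space (tot (vsp A)))"


(* dphi is only meaningful on edges of the orientation outside the maximal subtree;
   edge_iso below extends it to all edges. *)
record ('x, 'v, 'e, 'p, 'a, 'u, 'w) desing =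
  dgraph :: "('p, 'a, 'u, 'w) rel_graph"
  dorient :: "'a set"
  dtree :: "('p, 'a) sgraph"
  droot :: 'p
  drep :: "('x, 'v, 'e, 'p, 'a, 'u, 'w) tree_rep"
  dphi :: "'a \<Rightarrow> ('x \<rightharpoonup> 'x)"

definition edge_repr ::
  "('x, 'v, 'e) graph_field_act \<Rightarrow> ('x, 'v, 'e, 'p, 'a, 'u, 'w) desing \<Rightarrow>
     ('a \<Rightarrow> 'x \<Rightarrow> 'e) \<Rightarrow> 'a \<Rightarrow> 'e set" where
  "edge_repr A D s a =
     (if a \<in> edges (dtree D) then eimg (dgraph D) (drep D) a
      else if a \<in> dorient D then s a ` dom (dphi D a)
      else (let b = opp (ugraph (dgraph D)) a in fopp A ` s b ` dom (dphi D b)))"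

(* Connectedness of the underlying graph is implicit in the notion of a maximal subtree:
   the subtree then has all vertices of the graph, so that drep is defined on every X_P. *)
definition desingularization ::
  "'x measure \<Rightarrow> ('x \<times> 'x) set \<Rightarrow> ('x, 'v, 'e) graph_field_act \<Rightarrow>
     ('x, 'v, 'e, 'p, 'a, 'u, 'w) desing \<Rightarrow> bool" where
  "desingularization X R A D \<longleftrightarrow>
     (let H = dgraph D; G = ugraph H; T = dtree D; \<rho> = drep D; \<phi> = dphi D in
      graph_of_relations H \<and> connected_graph G \<and> orientation G (dorient D) \<and>
      maximal_subtree T G \<and>
      (\<forall>a\<in>dorient D - edges T. \<phi> a \<in> full_pseudogroup X R) \<and>
      arboretum_of_representatives X R A (H\<lparr>ugraph := T\<rparr>) (droot D) (space X) \<rho> \<and>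
      (\<exists>s.
        (\<forall>a\<in>dorient D - edges T.
           partial_section X (esp A) (dom (\<phi> a)) (s a) \<and>
           (\<forall>x\<in>dom (\<phi> a).
              forg A (s a x) \<in> vimg H \<rho> (origin G a) \<and>
              vact A (the (\<phi> a x)) x (fter A (s a x)) \<in> vimg H \<rho> (terminus G a)) \<and>
           rel_image (\<lambda>u. ident A \<rho> (origin G a) (inj_mor H (opp G a) u)) (erel H (opp G a)) =
             stab R (eact A) (dom (\<phi> a)) (s a) \<and>
           rel_image (\<lambda>u. ident A \<rho> (terminus G a) (inj_mor H a u)) (erel H a) =
             rel_image (\<lambda>x. the (\<phi> a x)) (stab R (eact A) (dom (\<phi> a)) (s a))) \<and>
        indexed_partition (edges G) (\<lambda>a. eorbit R A `` edge_repr A D s a) (space (tot (esp A)))))"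

definition edge_iso ::
  "('x, 'v, 'e) graph_field_act \<Rightarrow> ('x, 'v, 'e, 'p, 'a, 'u, 'w) desing \<Rightarrow> 'a \<Rightarrow> ('x \<rightharpoonup> 'x)" where
  "edge_iso A D a =
     (let H = dgraph D; G = ugraph H in
      if a \<in> edges (dtree D)
      then Some |` (prj (vsp A) ` vimg H (drep D) (origin G a))
      else if a \<in> dorient D then dphi D a
      else inv_map (dphi D (opp G a)))"

definition edge_subrelation ::
  "'x measure \<Rightarrow> ('x, 'v, 'e) graph_field_act \<Rightarrow> ('x, 'v, 'e, 'p, 'a, 'u, 'w) desing \<Rightarrow>
     ('x \<times> 'x) set" where
  "edge_subrelation X A D =
     generated_equiv (space X) (\<Union>a\<in>edges (ugraph (dgraph D)). Map.graph (edge_iso A D a))"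

definition vertex_relation ::
  "('x, 'v, 'e) graph_field_act \<Rightarrow> ('x, 'v, 'e, 'p, 'a, 'u, 'w) desing \<Rightarrow> 'p \<Rightarrow> ('x \<times> 'x) set"
where
  "vertex_relation A D P = rel_image (ident A (drep D) P) (vrel (dgraph D) P)"

end

theory Submission
  imports Defs
begin

text \<open>For \<open>x\<close> in \<open>X\<close> let \<open>B\<^sub>x\<close> be the fibre at \<open>x\<close> of the arboretum of representatives, a subtree of \<open>A\<^sub>x\<close>.
  A reduced word \<open>a\<^sub>1 \<dots> a\<^sub>n\<close> of edges outside the maximal subtree that is applicable at \<open>x\<close> and leads
  to \<open>y\<close> lifts to a walk in \<open>A\<^sub>x\<close> from \<open>B\<^sub>x\<close> to the translate \<open>(x,y)\<cdot>B\<^sub>y\<close>, which crosses between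
  consecutive translates along translates of the edges \<open>s\<^sub>a(_)\<close>. By condition (4) every edge of the
  arboretum has a well-defined invariant type in \<open>G\<close>; comparing types shows that the walk has no
  backtracking. As \<open>A\<^sub>x\<close> is a tree, \<open>B\<^sub>x\<close> and \<open>(x,y)\<cdot>B\<^sub>y\<close> are then disjoint unless the word is empty.
  Hence no nonempty reduced word has a fixed point, so the graphs of the \<open>\<phi>\<^sub>a\<close> form a treeing of
  \<open>R''\<close>; and two distinct \<open>R''\<close>-equivalent points never carry equivalent vertices of \<open>\<chi>(X\<^sub>P)\<close>.\<close>

section \<open>Reduced walks in Serre graphs\<close>

fun walk :: "('v, 'e) sgraph \<Rightarrow> 'v \<Rightarrow> 'e list \<Rightarrow> 'v \<Rightarrow> bool" where
  "walk G u [] v \<longleftrightarrow> u = v"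
| "walk G u (e # p) v \<longleftrightarrow> e \<in> edges G \<and> origin G e = u \<and> walk G (terminus G e) p v"

text \<open>The reversal is a parameter because the notion serves twice: with \<open>opp G\<close>
  for words over the graph \<open>G\<close>, and with \<open>fopp A\<close> for walks in the
  fibres.\<close>

abbreviation reduced :: "('e \<Rightarrow> 'e) \<Rightarrow> 'e list \<Rightarrow> bool" where
  "reduced r \<equiv> successively (\<lambda>e f. f \<noteq> r e)"

lemma walk_append: "walk G u (p @ q) v \<longleftrightarrow> (\<exists>w. walk G u p w \<and> walk G w q v)"
  by (induction p arbitrary: u) auto

lemma walk_edges: "walk G u p v \<Longrightarrow> set p \<subseteq> edges G"
  by (induction p arbitrary: u) auto

lemma walk_terminus_nth:
  "walk G u p v \<Longrightarrow> Suc i < length p \<Longrightarrow> terminus G (p ! i) = origin G (p ! Suc i)"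
proof (induction p arbitrary: u i)
  case (Cons e p)
  then show ?case by (cases i; cases p) auto
qed simp

lemma walk_terminus_last: "walk G u p v \<Longrightarrow> p \<noteq> [] \<Longrightarrow> terminus G (last p) = v"
  by (induction p arbitrary: u) auto

lemma walk_origin_hd: "walk G u p v \<Longrightarrow> p \<noteq> [] \<Longrightarrow> origin G (hd p) = u"
  by (cases p) auto

lemma reduced_nth: "reduced r p \<Longrightarrow> Suc i < length p \<Longrightarrow> p ! Suc i \<noteq> r (p ! i)"
proof (induction p arbitrary: i)
  case (Cons e p)
  then show ?case by (cases i; cases p) (auto simp: successively_Cons)
qed simp

text \<open>Induction along a path, prepending edges: a new first edge either keeps the walk reduced
  or is the opposite of the next edge, and then the two cancel.\<close>

lemma connected_reduced_walk:
  assumes G: "serre_graph G" "connected_graph G" and "u \<in> verts G" "v \<in> verts G"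
  obtains p where "walk G u p v" "reduced (opp G) p"
proof -
  let ?E = "(\<lambda>a. (origin G a, terminus G a)) ` edges G"
  have "(u, v) \<in> ?E\<^sup>*"
    using assms unfolding connected_graph_def by blast
  then have "\<exists>p. walk G u p v \<and> reduced (opp G) p"
  proof (induction rule: converse_rtrancl_induct)
    case base
    have "walk G v [] v \<and> reduced (opp G) []" by simp
    then show ?case by blast
  next
    case (step y z)
    then obtain p e where p: "walk G z p v" "reduced (opp G) p"
      and e: "e \<in> edges G" "y = origin G e" "z = terminus G e" by auto
    show ?case
    proof (cases "p = [] \<or> hd p \<noteq> opp G e")
      case True
      then have "walk G y (e # p) v \<and> reduced (opp G) (e # p)"
        using p e by (auto simp: successively_Cons)
      then show ?thesis by blast
    next
      case False
      then obtain q where q: "p = opp G e # q" by (cases p) auto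
      then have "walk G y q v \<and> reduced (opp G) q"
        using p e G(1) by (auto simp: successively_Cons serre_graph_def)
      then show ?thesis by blast
    qed
  qed
  then show thesis using that by blast
qed

text \<open>Induction on the length. A repeated origin cuts out a shorter closed reduced walk. With
  all origins distinct the walk is a circuit unless its first edge undoes its last one; then both
  are stripped off.\<close>

lemma closed_reduced_walk_circuit:
  assumes G: "serre_graph G"
  shows "walk G u p u \<Longrightarrow> reduced (opp G) p \<Longrightarrow> p \<noteq> [] \<Longrightarrow> \<exists>c. circuit G c"
proof (induction "length p" arbitrary: u p rule: less_induct)
  case less
  note w = less.prems(1) and r = less.prems(2) and ne = less.prems(3)
  show ?case
  proof (cases "distinct (map (origin G) p)")
    case False
    then obtain xs ys zs o' where "map (origin G) p = xs @ [o'] @ ys @ [o'] @ zs"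
      using not_distinct_decomp by blast
    then obtain p1 r where r1: "p = p1 @ r" "map (origin G) r = o' # ys @ [o'] @ zs"
      unfolding map_eq_append_conv by fastforce
    then obtain e q where r2: "r = e # q" "origin G e = o'" "map (origin G) q = ys @ [o'] @ zs"
      unfolding map_eq_Cons_conv by fastforce
    then obtain p2 r' where r3: "q = p2 @ r'" "map (origin G) r' = o' # zs"
      unfolding map_eq_append_conv by fastforce
    then obtain f p3 where "r' = f # p3" "origin G f = o'"
      unfolding map_eq_Cons_conv by fastforce
    \<comment> \<open>Here \<open>e\<close> and \<open>f\<close> have the same origin, so
      \<open>e # p2\<close> closes up at that vertex. As a factor of \<open>p\<close> it is reduced,
      and it is shorter since \<open>f\<close> is left out.\<close>
    then have p: "p = p1 @ e # p2 @ f # p3" "origin G e = origin G f"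
      using r1 r2 r3 by auto
    have "walk G (origin G e) (e # p2) (origin G e)"
      using w unfolding p by (auto simp: walk_append p(2))
    moreover have "reduced (opp G) (e # p2)"
    proof -
      have "p = p1 @ (e # p2) @ (f # p3)" using p by simp
      then show ?thesis using r by (simp only: successively_append_iff)
    qed
    ultimately show ?thesis using less.hyps[of "e # p2" "origin G e"] p by simp
  next
    case dist: True
    show ?thesis
    proof (cases "hd p = opp G (last p)")
      case False
      have "circuit G p"
        unfolding circuit_def
      proof (intro conjI allI impI)
        fix i assume i: "i < length p"
        show "terminus G (p ! i) = origin G (p ! (Suc i mod length p))"
        proof (cases "Suc i < length p")
          case True
          then show ?thesis using walk_terminus_nth[OF w] by simp
        next
          case False
          then have "Suc i = length p" using i by simp
          then show ?thesis
            using walk_terminus_last[OF w ne] walk_origin_hd[OF w ne] ne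
            by (simp add: last_conv_nth hd_conv_nth flip: \<open>Suc i = length p\<close>)
        qed
        show "p ! (Suc i mod length p) \<noteq> opp G (p ! i)"
        proof (cases "Suc i < length p")
          case True
          then show ?thesis using reduced_nth[OF r] by simp
        next
          case F: False
          then have "Suc i = length p" using i by simp
          then show ?thesis
            using False ne by (simp add: last_conv_nth hd_conv_nth flip: \<open>Suc i = length p\<close>)
        qed
      qed (use walk_edges[OF w] ne dist in auto)
      then show ?thesis by blast
    next
      case True
      obtain e q where p: "p = e # q" using ne by (cases p) auto
      have ee: "e \<in> edges G" using w p by simp
      have "q \<noteq> []" using True G ee unfolding p serre_graph_def by auto
      then obtain m f where q: "q = m @ [f]" by (metis append_butlast_last_id)
      have f: "e = opp G f" "f \<in> edges G" using True p q walk_edges[OF w] by auto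
      have opp: "opp G e = f" using f G unfolding serre_graph_def by auto
      \<comment> \<open>An empty \<open>m\<close> would make \<open>p\<close> the pair
        \<open>e\<close>, \<open>opp G e\<close>, which is not reduced.\<close>
      have "m \<noteq> []" using r opp unfolding p q by auto
      moreover have "reduced (opp G) m"
        using r unfolding p q by (auto simp: successively_Cons successively_append_iff)
      moreover have "walk G (terminus G e) m (terminus G e)"
        using w f G unfolding p q serre_graph_def by (auto simp: walk_append)
      ultimately show ?thesis using less.hyps[of m "terminus G e"] p q by simp
    qed
  qed
qed

lemma is_tree_closed_reduced_walk:
  "is_tree G \<Longrightarrow> walk G u p u \<Longrightarrow> reduced (opp G) p \<Longrightarrow> p = []"
  using closed_reduced_walk_circuit[of G u p] unfolding is_tree_def by auto

section \<open>Maximal subtrees of connected graphs\<close>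

text \<open>A subtree that misses a vertex can be enlarged: by connectedness some edge
  \<open>a\<close> leaves it, and adding \<open>a\<close>, its opposite and its terminus creates a
  leaf but no circuit.\<close>

lemma maximal_subtree_spanning:
  assumes G: "serre_graph G" "connected_graph G" and T: "maximal_subtree T G"
  shows "verts T = verts G"
proof (rule ccontr)
  assume neq: "verts T \<noteq> verts G"
  have sub: "subgraph T G" and tree: "is_tree T"
    and max: "\<And>T'. subgraph T' G \<Longrightarrow> is_tree T' \<Longrightarrow> subgraph T T' \<Longrightarrow> verts T' = verts T"
    using T unfolding maximal_subtree_def by blast+
  have sG: "\<And>a. a \<in> edges G \<Longrightarrow> origin G a \<in> verts G \<and> terminus G a \<in> verts G \<and>
      opp G a \<in> edges G \<and> opp G a \<noteq> a \<and> opp G (opp G a) = a \<and>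
      origin G (opp G a) = terminus G a \<and> terminus G (opp G a) = origin G a"
    using G(1) unfolding serre_graph_def by blast
  have eq: "\<And>a. a \<in> edges T \<Longrightarrow>
      origin T a = origin G a \<and> terminus T a = terminus G a \<and> opp T a = opp G a \<and> a \<in> edges G"
    and vT: "verts T \<subseteq> verts G"
    using sub unfolding subgraph_def by auto
  have sT: "\<And>a. a \<in> edges T \<Longrightarrow>
      origin G a \<in> verts T \<and> terminus G a \<in> verts T \<and> opp G a \<in> edges T"
  proof -
    fix b assume b: "b \<in> edges T"
    have "serre_graph T" using sub unfolding subgraph_def by blast
    then have "origin T b \<in> verts T" "terminus T b \<in> verts T" "opp T b \<in> edges T"
      using b unfolding serre_graph_def by auto
    then show "origin G b \<in> verts T \<and> terminus G b \<in> verts T \<and> opp G b \<in> edges T"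
      using eq[OF b] by simp
  qed
  obtain u where u: "u \<in> verts T" using tree unfolding is_tree_def connected_graph_def by auto
  obtain v where v: "v \<in> verts G" "v \<notin> verts T" using neq vT by auto
  have "(u, v) \<in> ((\<lambda>a. (origin G a, terminus G a)) ` edges G)\<^sup>*"
    using G(2) u v vT unfolding connected_graph_def by blast
  \<comment> \<open>Along the path from \<open>u\<close> to \<open>v\<close> some edge must leave
    \<open>T\<close>.\<close>
  then have "v \<in> verts T \<or> (\<exists>a\<in>edges G. origin G a \<in> verts T \<and> terminus G a \<notin> verts T)"
    by (induction rule: rtrancl_induct) (use u in auto)
  then obtain a where a: "a \<in> edges G" "origin G a \<in> verts T" "terminus G a \<notin> verts T"
    using v by blast
  define T' where "T' = G\<lparr>verts := insert (terminus G a) (verts T),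
    edges := insert a (insert (opp G a) (edges T))\<rparr>"
  have T'_simps: "verts T' = insert (terminus G a) (verts T)"
    "edges T' = insert a (insert (opp G a) (edges T))"
    "origin T' = origin G" "terminus T' = terminus G" "opp T' = opp G"
    unfolding T'_def by simp_all
  have ser: "serre_graph T'"
  proof -
    have "opp G a \<noteq> a" "a \<noteq> opp G a" using sG a by metis+
    then show ?thesis
      unfolding serre_graph_def T'_simps using a sG sT eq by auto
  qed
  have s1: "subgraph T' G"
    unfolding subgraph_def using ser sG[OF a(1)] vT eq by (auto simp: T'_simps a(1))
  have s2: "subgraph T T'"
    using sub eq unfolding subgraph_def by (auto simp: T'_simps)
  have conn: "connected_graph T'"
  proof -
    let ?E = "(\<lambda>b. (origin T' b, terminus T' b)) ` edges T'"
    let ?F = "(\<lambda>b. (origin T b, terminus T b)) ` edges T"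
    have FE: "?F \<subseteq> ?E" using eq by (force simp: T'_simps)
    have F: "(x, y) \<in> ?E\<^sup>*" if "x \<in> verts T" "y \<in> verts T" for x y
      using that tree rtrancl_mono[OF FE] unfolding is_tree_def connected_graph_def by blast
    have 1: "(origin G a, terminus G a) \<in> ?E" by (force simp: T'_simps)
    have 2: "(terminus G a, origin G a) \<in> ?E"
      using sG[OF a(1)] by (force simp: T'_simps)
    have "(x, y) \<in> ?E\<^sup>*" if x: "x \<in> verts T'" and y: "y \<in> verts T'" for x y
    proof -
      have "(x, origin G a) \<in> ?E\<^sup>*"
        using x F[OF _ a(2)] 2 unfolding T'_simps(1) by blast
      moreover have "(origin G a, y) \<in> ?E\<^sup>*"
        using y F[OF a(2)] 1 unfolding T'_simps(1) by blast
      ultimately show ?thesis by (rule rtrancl_trans)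
    qed
    then show ?thesis unfolding connected_graph_def by (auto simp: T'_simps(1))
  qed
  have "\<not> circuit T' p" for p
  proof
    assume c: "circuit T' p"
    have pe: "\<And>i. i < length p \<Longrightarrow> p ! i \<in> edges T'"
      using c unfolding circuit_def by auto
    have step: "\<And>i. i < length p \<Longrightarrow> terminus G (p ! i) = origin G (p ! (Suc i mod length p)) \<and>
        p ! (Suc i mod length p) \<noteq> opp G (p ! i)"
      using c unfolding circuit_def T'_simps by blast
    have ne: "p \<noteq> []" using c unfolding circuit_def by blast
    \<comment> \<open>The terminus of \<open>a\<close> is a leaf of \<open>T'\<close>: the only edge
      starting there is \<open>opp G a\<close>, which would backtrack after
      \<open>a\<close>.\<close>
    have 1: "p ! i \<noteq> a" if i: "i < length p" for i
    proof
      assume "p ! i = a"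
      moreover have "p ! (Suc i mod length p) \<in> edges T'" using pe ne by auto
      ultimately show False
        using step[OF i] a sT unfolding T'_simps(2) by (auto simp: sG)
    qed
    have 2: "p ! i \<noteq> opp G a" if i: "i < length p" for i
    proof
      assume pi: "p ! i = opp G a"
      \<comment> \<open>\<open>j\<close> is the cyclic predecessor of \<open>i\<close>, that is
        \<open>length p - 1\<close> for \<open>i = 0\<close>. The only edge of \<open>T'\<close>
        ending at the leaf is \<open>a\<close>, which is already excluded.\<close>
      obtain j where j: "j < length p" "Suc j mod length p = i"
      proof (cases i)
        case 0
        then show ?thesis using that[of "length p - 1"] ne by auto
      next
        case (Suc k)
        then show ?thesis using that[of k] i by auto
      qed
      have "terminus G (p ! j) = terminus G a"
        using step[OF j(1)] pi j(2) sG[OF a(1)] by auto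
      then have "p ! j = a"
        using pe[OF j(1)] sT[of "p ! j"] sG[OF a(1)] a unfolding T'_simps(2) by auto
      then show False using 1 j by blast
    qed
    have sp: "set p \<subseteq> edges T"
      using pe 1 2 unfolding T'_simps(2) by (auto simp: in_set_conv_nth)
    moreover have "map (origin T) p = map (origin T') p"
      using sp eq by (auto simp: T'_simps)
    moreover have "terminus T (p ! i) = origin T (p ! (Suc i mod length p)) \<and>
        p ! (Suc i mod length p) \<noteq> opp T (p ! i)" if "i < length p" for i
    proof -
      have "p ! i \<in> edges T" "p ! (Suc i mod length p) \<in> edges T"
        using sp that ne by auto
      then show ?thesis using step[OF that] eq by auto
    qed
    ultimately have "circuit T p"
      using c unfolding circuit_def by metis
    then show False using tree unfolding is_tree_def by blast
  qed
  then have "is_tree T'" using ser conn unfolding is_tree_def by blast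
  then have "verts T' = verts T" using max s1 s2 by blast
  then show False using a T'_simps(1) by auto
qed


section \<open>Borel relations\<close>

text \<open>Distinct points are separated by a member of a countable base, so the complement of the
  diagonal is a countable union of measurable rectangles.\<close>

lemma standard_borel_diagonal:
  assumes "standard_borel M"
  shows "Id_on (space M) \<in> sets (M \<Otimes>\<^sub>M M)"
proof -
  obtain T where T: "completely_metrizable_space T" "second_countable T" "topspace T = space M"
    "sets M = sigma_sets (topspace T) {U. openin T U}"
    using assms unfolding standard_borel_def by blast
  obtain B where B: "countable B" "\<And>V. V \<in> B \<Longrightarrow> openin T V"
    "\<And>U x. openin T U \<Longrightarrow> x \<in> U \<Longrightarrow> \<exists>V\<in>B. x \<in> V \<and> V \<subseteq> U"
    using T(2) unfolding second_countable_def by metis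
  have BM: "V \<in> sets M" if "V \<in> B" for V
    using B(2)[OF that] unfolding T(4) by (auto intro: sigma_sets.Basic)
  have t1: "t1_space T"
    using T(1) completely_metrizable_imp_metrizable_space metrizable_imp_t1_space by blast
  have "Id_on (space M) = space M \<times> space M - (\<Union>V\<in>B. V \<times> (space M - V))"
  proof -
    have "\<exists>V\<in>B. x \<in> V \<and> y \<notin> V" if xy: "x \<in> space M" "y \<in> space M" "x \<noteq> y" for x y
    proof -
      obtain U where "openin T U" "x \<in> U" "y \<notin> U"
        using xy t1 unfolding t1_space_def T(3) by metis
      then show ?thesis using B(3) by blast
    qed
    then show ?thesis by (auto simp: Id_on_def)
  qed
  also have "\<dots> \<in> sets (M \<Otimes>\<^sub>M M)"
    using B(1) BM by (intro sets.Diff sets.countable_UN' pair_measureI) auto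
  finally show ?thesis .
qed

text \<open>The composite is the preimage of \<open>S\<close> under the map taking
  \<open>(x, y)\<close> to \<open>(\<phi> x, y)\<close>. Starting from the diagonal, this gives
  Borelness of words letter by letter.\<close>

lemma sets_relcomp_partial_map:
  assumes "dom \<phi> \<in> sets M" "(\<lambda>x. the (\<phi> x)) \<in> restrict_space M (dom \<phi>) \<rightarrow>\<^sub>M M"
    and S: "S \<in> sets (M \<Otimes>\<^sub>M M)"
  shows "Map.graph \<phi> O S \<in> sets (M \<Otimes>\<^sub>M M)"
proof -
  let ?N = "restrict_space M (dom \<phi>) \<Otimes>\<^sub>M M"
  let ?g = "\<lambda>p. (the (\<phi> (fst p)), snd p)"
  have sub: "dom \<phi> \<subseteq> space M" using assms(1) by (rule sets.sets_into_space)
  have g: "?g \<in> ?N \<rightarrow>\<^sub>M M \<Otimes>\<^sub>M M"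
    using measurable_compose[OF measurable_fst assms(2)] by measurable
  have "?g -` S \<inter> space ?N \<in> sets ?N"
    using g S by (rule measurable_sets)
  moreover have "?g -` S \<inter> space ?N = Map.graph \<phi> O S"
    using sets.sets_into_space[OF S] sub
    by (auto simp: space_pair_measure space_restrict_space Map.graph_def)
  ultimately have N: "Map.graph \<phi> O S \<in> sets ?N" by simp
  \<comment> \<open>So far measurability is known in the product \<open>?N\<close> with a restricted
    factor. The identity from \<open>?K\<close> to \<open>?N\<close> carries it over to a
    restriction of the full product.\<close>
  let ?K = "restrict_space (M \<Otimes>\<^sub>M M) (dom \<phi> \<times> space M)"
  have dM: "dom \<phi> \<times> space M \<in> sets (M \<Otimes>\<^sub>M M)" using assms(1) by auto
  have "fst \<in> ?K \<rightarrow>\<^sub>M restrict_space M (dom \<phi>)"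
    by (intro measurable_restrict_space3) auto
  moreover have "snd \<in> ?K \<rightarrow>\<^sub>M M"
    by (intro measurable_restrict_space1) auto
  ultimately have id: "(\<lambda>p. p) \<in> ?K \<rightarrow>\<^sub>M ?N"
    by (simp add: measurable_pair_iff comp_def)
  have "Map.graph \<phi> O S \<subseteq> space ?K"
    using sets.sets_into_space[OF S] sub
    by (auto simp: space_pair_measure space_restrict_space Map.graph_def)
  then have "Map.graph \<phi> O S \<in> sets ?K"
    using measurable_sets[OF id N] by (simp add: Int_absorb2)
  then show ?thesis
    using dM by (simp add: sets_restrict_space_iff)
qed

section \<open>Partial isomorphisms and their inverses\<close>

lemma dom_inv_map: "dom (inv_map \<phi>) = ran \<phi>"
  by (auto simp: inv_map_def split: if_splits)

lemma inv_map_Some_iff: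
  assumes "inj_on \<phi> (dom \<phi>)"
  shows "inv_map \<phi> y = Some x \<longleftrightarrow> \<phi> x = Some y"
proof -
  have u: "(THE z. \<phi> z = Some y) = x" if "\<phi> x = Some y" for x
    using that by (intro the_equality) (simp, metis assms domI inj_onD)
  show ?thesis
    unfolding inv_map_def using u by (auto simp: ran_def split: if_splits)
qed

text \<open>Measurability of the inverse is included because edges opposite to the orientation carry
  inverse maps.\<close>

lemma full_pseudogroupD:
  assumes "\<phi> \<in> full_pseudogroup X R"
  shows "dom \<phi> \<in> sets X" "ran \<phi> \<in> sets X" "Map.graph \<phi> \<subseteq> R" "inj_on \<phi> (dom \<phi>)"
    "(\<lambda>x. the (\<phi> x)) \<in> restrict_space X (dom \<phi>) \<rightarrow>\<^sub>M X"
    "(\<lambda>x. the (inv_map \<phi> x)) \<in> restrict_space X (ran \<phi>) \<rightarrow>\<^sub>M X"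
proof -
  let ?f = "\<lambda>x. the (\<phi> x)"
  let ?D = "restrict_space X (dom \<phi>)" and ?E = "restrict_space X (ran \<phi>)"
  show dr: "dom \<phi> \<in> sets X" "ran \<phi> \<in> sets X" "Map.graph \<phi> \<subseteq> R"
    using assms unfolding full_pseudogroup_def by auto
  then have sp: "space ?D = dom \<phi>" "space ?E = ran \<phi>"
    using sets.sets_into_space by (auto simp: space_restrict_space)
  have iso: "borel_iso ?D ?E ?f"
    using assms unfolding full_pseudogroup_def by auto
  then have f: "?f \<in> ?D \<rightarrow>\<^sub>M ?E" and bij: "bij_betw ?f (dom \<phi>) (ran \<phi>)"
    and g: "the_inv_into (dom \<phi>) ?f \<in> ?E \<rightarrow>\<^sub>M ?D"
    unfolding borel_iso_def sp by auto
  show "?f \<in> ?D \<rightarrow>\<^sub>M X"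
    using f measurable_restrict_space2_iff by blast
  have inj_f: "inj_on ?f (dom \<phi>)" using bij by (rule bij_betw_imp_inj_on)
  show inj: "inj_on \<phi> (dom \<phi>)"
    using inj_f by (auto simp: inj_on_def)
  have "the_inv_into (dom \<phi>) ?f y = the (inv_map \<phi> y)" if y: "y \<in> ran \<phi>" for y
  proof -
    obtain x where x: "\<phi> x = Some y" using y by (auto simp: ran_def)
    then have "the_inv_into (dom \<phi>) ?f y = x"
      by (intro the_inv_into_f_eq[OF inj_f]) auto
    then show ?thesis using x inv_map_Some_iff[OF inj] by (metis option.sel)
  qed
  moreover have "the_inv_into (dom \<phi>) ?f \<in> ?E \<rightarrow>\<^sub>M X"
    using g measurable_restrict_space2_iff by blast
  ultimately show "(\<lambda>x. the (inv_map \<phi> x)) \<in> ?E \<rightarrow>\<^sub>M X"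
    using measurable_cong[of ?E "the_inv_into (dom \<phi>) ?f" "\<lambda>x. the (inv_map \<phi> x)" X] sp by auto
qed

lemma graph_inv_map: "inj_on \<phi> (dom \<phi>) \<Longrightarrow> Map.graph (inv_map \<phi>) = (Map.graph \<phi>)\<inverse>"
  by (auto simp: Map.graph_def inv_map_Some_iff)


section \<open>Lifting words in the \<open>\<phi>\<^sub>a\<close> to walks in the fibres\<close>

text \<open>If moving \<open>e\<close> to the fibre of \<open>r\<close> gives \<open>r\<close>, then
  so does moving it there by way of \<open>x\<close>. Hence saturations are invariant under the
  action, which makes edge types invariant below.\<close>

lemma orbit_rel_act:
  assumes F: "borel_action X Q F \<alpha>" and Q: "equiv (space X) Q"
    and "(r, e) \<in> orbit_rel Q F \<alpha>" "e \<in> fibre F y" "(x, y) \<in> Q"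
  shows "(r, \<alpha> x y e) \<in> orbit_rel Q F \<alpha>"
proof -
  have r: "r \<in> space (tot F)" "(prj F r, y) \<in> Q" "\<alpha> (prj F r) y e = r"
    using assms(3,4) unfolding orbit_rel_def fibre_def by auto
  have "\<alpha> x y e \<in> fibre F x"
    using F assms(4,5) unfolding borel_action_def by blast
  moreover have yx: "(y, x) \<in> Q" using Q assms(5) unfolding equiv_def sym_def by blast
  moreover have rx: "(prj F r, x) \<in> Q" using Q r(2) yx unfolding equiv_def trans_def by blast
  moreover have "\<alpha> (prj F r) x (\<alpha> x y e) = r"
  proof -
    have "\<alpha> (prj F r) x (\<alpha> x y e) = \<alpha> (prj F r) y e"
      using F rx assms(4,5) unfolding borel_action_def by blast
    then show ?thesis using r(3) by simp
  qed
  ultimately show ?thesis using r(1) unfolding orbit_rel_def fibre_def by simp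
qed

lemma orbit_rel_refl:
  assumes "borel_action X Q F \<alpha>" "equiv (space X) Q" "e \<in> fibre F x" "x \<in> space X"
  shows "(e, e) \<in> orbit_rel Q F \<alpha>"
  using assms unfolding borel_action_def orbit_rel_def fibre_def equiv_def refl_on_def by auto

text \<open>The sections \<open>s\<close> are fixed rather than existentially bound, because edge
  types and crossing edges depend on their choice.\<close>

locale desingularized =
  fixes X :: "'x measure"
    and R :: "('x \<times> 'x) set"
    and A :: "('x, 'v, 'e) graph_field_act"
    and D :: "('x, 'v, 'e, 'p, 'a, 'u, 'w) desing"
    and s :: "'a \<Rightarrow> 'x \<Rightarrow> 'e"
    and G T
  defines "G \<equiv> ugraph (dgraph D)" and "T \<equiv> dtree D"
  assumes std: "standard_borel X"
    and cbe: "countable_borel_equiv X R"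
    and arb: "arboretum X R A"
    and gor: "graph_of_relations (dgraph D)"
    and conn: "connected_graph G"
    and orient: "orientation G (dorient D)"
    and maxT: "maximal_subtree T G"
    and phi: "a \<in> dorient D - edges T \<Longrightarrow> dphi D a \<in> full_pseudogroup X R"
    and reps: "arboretum_of_representatives X R A (dgraph D\<lparr>ugraph := T\<rparr>) (droot D) (space X) (drep D)"
    and sect: "a \<in> dorient D - edges T \<Longrightarrow> partial_section X (esp A) (dom (dphi D a)) (s a)"
    and sect_origin: "a \<in> dorient D - edges T \<Longrightarrow> x \<in> dom (dphi D a) \<Longrightarrow>
      forg A (s a x) \<in> vimg (dgraph D) (drep D) (origin G a)"
    and sect_terminus: "a \<in> dorient D - edges T \<Longrightarrow> x \<in> dom (dphi D a) \<Longrightarrow>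
      vact A (the (dphi D a x)) x (fter A (s a x)) \<in> vimg (dgraph D) (drep D) (terminus G a)"
    and part: "indexed_partition (edges G) (\<lambda>a. eorbit R A `` edge_repr A D s a) (space (tot (esp A)))"
begin

section \<open>Elementary properties of the relation, the action and the graphs\<close>

lemma R_equiv: "equiv (space X) R"
  using cbe unfolding countable_borel_equiv_def borel_equiv_def by blast

lemma R_sym: "(x, y) \<in> R \<Longrightarrow> (y, x) \<in> R"
  using R_equiv unfolding equiv_def sym_def by blast

lemma R_space: "(x, y) \<in> R \<Longrightarrow> x \<in> space X \<and> y \<in> space X"
  using R_equiv unfolding equiv_def by blast

lemma R_trans: "(x, y) \<in> R \<Longrightarrow> (y, z) \<in> R \<Longrightarrow> (x, z) \<in> R"
  using R_equiv unfolding equiv_def trans_def by blast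

lemma field: "borel_graph_field X R A"
  using arb unfolding arboretum_def by blast

lemma actions: "borel_action X R (vsp A) (vact A)" "borel_action X R (esp A) (eact A)"
  using field unfolding borel_graph_field_def by blast+

lemma vact_fibre: "(x, y) \<in> R \<Longrightarrow> f \<in> fibre (vsp A) y \<Longrightarrow> vact A x y f \<in> fibre (vsp A) x"
  using actions(1) unfolding borel_action_def by blast

lemma eact_fibre: "(x, y) \<in> R \<Longrightarrow> f \<in> fibre (esp A) y \<Longrightarrow> eact A x y f \<in> fibre (esp A) x"
  using actions(2) unfolding borel_action_def by blast

lemma vact_id: "y \<in> space X \<Longrightarrow> f \<in> fibre (vsp A) y \<Longrightarrow> vact A y y f = f"
  using actions(1) unfolding borel_action_def by blast

lemma eact_id: "y \<in> space X \<Longrightarrow> f \<in> fibre (esp A) y \<Longrightarrow> eact A y y f = f"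
  using actions(2) unfolding borel_action_def by blast

lemma vact_vact:
  "(x, y) \<in> R \<Longrightarrow> (y, z) \<in> R \<Longrightarrow> f \<in> fibre (vsp A) z \<Longrightarrow>
   vact A x y (vact A y z f) = vact A x z f"
  using actions(1) unfolding borel_action_def by blast

lemma eact_eact:
  "(x, y) \<in> R \<Longrightarrow> (y, z) \<in> R \<Longrightarrow> f \<in> fibre (esp A) z \<Longrightarrow>
   eact A x y (eact A y z f) = eact A x z f"
  using actions(2) unfolding borel_action_def by blast

lemma vact_inverse:
  "(x, y) \<in> R \<Longrightarrow> f \<in> fibre (vsp A) y \<Longrightarrow> vact A y x (vact A x y f) = f"
  using vact_vact R_sym R_space vact_id by metis

lemma eact_inverse:
  "(x, y) \<in> R \<Longrightarrow> f \<in> fibre (esp A) y \<Longrightarrow> eact A y x (eact A x y f) = f"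
  using eact_eact R_sym R_space eact_id by metis

lemma end_morphisms:
  "fibred_morphism R (esp A) (eact A) (vsp A) (vact A) (forg A)"
  "fibred_morphism R (esp A) (eact A) (vsp A) (vact A) (fter A)"
  "fibred_morphism R (esp A) (eact A) (esp A) (eact A) (fopp A)"
  using field unfolding borel_graph_field_def by blast+

lemma end_fibre:
  assumes "e \<in> fibre (esp A) x"
  shows "forg A e \<in> fibre (vsp A) x" "fter A e \<in> fibre (vsp A) x" "fopp A e \<in> fibre (esp A) x"
  using assms end_morphisms unfolding fibred_morphism_def fibre_def
  by (auto dest: measurable_space)

lemma end_act:
  assumes "(x, y) \<in> R" "e \<in> fibre (esp A) y"
  shows "forg A (eact A x y e) = vact A x y (forg A e)"
    "fter A (eact A x y e) = vact A x y (fter A e)"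
    "fopp A (eact A x y e) = eact A x y (fopp A e)"
  using assms end_morphisms unfolding fibred_morphism_def by blast+

lemma opp_A:
  assumes "e \<in> fibre (esp A) x"
  shows "fopp A (fopp A e) = e" "forg A (fopp A e) = fter A e" "fter A (fopp A e) = forg A e"
  using assms field unfolding borel_graph_field_def serre_graph_def total_graph_def fibre_def by auto

lemma serre_G: "serre_graph G"
  using gor unfolding graph_of_relations_def G_def Let_def by blast

lemma countable_edges_G: "countable (edges G)"
  using gor unfolding graph_of_relations_def G_def Let_def by blast

lemma opp_G:
  assumes "a \<in> edges G"
  shows "opp G a \<in> edges G" "opp G a \<noteq> a" "opp G (opp G a) = a"
    "origin G a \<in> verts G" "terminus G a \<in> verts G"
  using serre_G assms unfolding serre_graph_def by blast+

lemma sub_T: "subgraph T G"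
  using maxT unfolding maximal_subtree_def by blast

lemma edges_T: "edges T \<subseteq> edges G"
  using sub_T unfolding subgraph_def by blast

lemma opp_T_iff: "a \<in> edges G \<Longrightarrow> opp G a \<in> edges T \<longleftrightarrow> a \<in> edges T"
proof -
  have "opp G b \<in> edges T" if "b \<in> edges T" for b
    using sub_T that unfolding subgraph_def serre_graph_def by auto
  then show "a \<in> edges G \<Longrightarrow> opp G a \<in> edges T \<longleftrightarrow> a \<in> edges T"
    using opp_G(3) by metis
qed

lemma orient_iff: "a \<in> edges G \<Longrightarrow> a \<in> dorient D \<longleftrightarrow> opp G a \<notin> dorient D"
  using orient unfolding orientation_def by blast

lemma dorient_edges: "dorient D \<subseteq> edges G"
  using orient unfolding orientation_def by blast

lemma verts_T: "verts T = verts G"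
  using maximal_subtree_spanning serre_G conn maxT by blast

section \<open>Representative trees and edge types\<close>

text \<open>\<open>V\<close> and \<open>E\<close> are the vertices and edges of the arboretum of
  representatives inside \<open>A\<close>, and \<open>rep_tree x\<close> below is the tree
  \<open>B\<^sub>x\<close>. The graph is cut down to \<open>T\<close> because the representation
  concerns the maximal subtree.\<close>

definition V :: "'v set" where
  "V = rvert (drep D) ` space (vtotal (dgraph D\<lparr>ugraph := T\<rparr>))"

definition E :: "'e set" where
  "E = redge (drep D) ` space (etotal (dgraph D\<lparr>ugraph := T\<rparr>))"

abbreviation rep_tree :: "'x \<Rightarrow> ('v, 'e) sgraph" where
  "rep_tree x \<equiv> fibre_graph (subfield A V E) x"

lemma sub_arb: "sub_arboretum A (space X) V E"
  using reps unfolding arboretum_of_representatives_def representation_def Let_def V_def E_def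
  by blast

lemma rep_tree_simps:
  "verts (rep_tree x) = V \<inter> fibre (vsp A) x" "edges (rep_tree x) = E \<inter> fibre (esp A) x"
  "origin (rep_tree x) = forg A" "terminus (rep_tree x) = fter A" "opp (rep_tree x) = fopp A"
  by (auto simp: fibre_graph_def subfield_def fibre_def space_restrict_space)

lemma fibre_graph_simps:
  "verts (fibre_graph A x) = fibre (vsp A) x" "edges (fibre_graph A x) = fibre (esp A) x"
  "origin (fibre_graph A x) = forg A" "terminus (fibre_graph A x) = fter A"
  "opp (fibre_graph A x) = fopp A"
  by (auto simp: fibre_graph_def)

lemma rep_tree: "x \<in> space X \<Longrightarrow> is_tree (rep_tree x)"
  using sub_arb unfolding sub_arboretum_def by blast

lemma walk_rep_tree: "walk (rep_tree x) u p v \<Longrightarrow> walk (fibre_graph A x) u p v"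
  by (induction p arbitrary: u) (auto simp: rep_tree_simps fibre_graph_simps)

text \<open>Here the maximal subtree has to be spanning.\<close>

lemma vimg_V: "P \<in> verts G \<Longrightarrow> vimg (dgraph D) (drep D) P \<subseteq> V"
  using verts_T unfolding vimg_def V_def vtotal_def space_coprod_space by auto

text \<open>Membership in \<open>sat a\<close> says that an edge of the arboretum has type
  \<open>a\<close>; by \<open>part\<close> every edge has exactly one type in
  \<open>G\<close>.\<close>

definition sat :: "'a \<Rightarrow> 'e set" where
  "sat a = eorbit R A `` edge_repr A D s a"

lemma sat_disjoint: "a \<in> edges G \<Longrightarrow> b \<in> edges G \<Longrightarrow> e \<in> sat a \<Longrightarrow> e \<in> sat b \<Longrightarrow> a = b"
  using part unfolding indexed_partition_def disjoint_family_on_def sat_def by blast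

lemma sat_act:
  "e \<in> sat a \<Longrightarrow> (x, y) \<in> R \<Longrightarrow> e \<in> fibre (esp A) y \<Longrightarrow> eact A x y e \<in> sat a"
  using orbit_rel_act[OF actions(2) R_equiv] unfolding sat_def by blast

lemma sat_repr:
  "e \<in> edge_repr A D s a \<Longrightarrow> e \<in> fibre (esp A) x \<Longrightarrow> x \<in> space X \<Longrightarrow> e \<in> sat a"
  using orbit_rel_refl[OF actions(2) R_equiv] unfolding sat_def by blast

lemma E_sat:
  assumes "e \<in> E" "e \<in> fibre (esp A) x" "x \<in> space X"
  shows "\<exists>a\<in>edges T. e \<in> sat a"
proof -
  obtain a u where a: "a \<in> edges T" "u \<in> space (espace (dgraph D) a)" "e = redge (drep D) (a, u)"
    using assms(1) unfolding E_def etotal_def space_coprod_space by auto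
  then have "e \<in> edge_repr A D s a"
    unfolding edge_repr_def eimg_def T_def by auto
  then show ?thesis using sat_repr assms a by blast
qed

section \<open>Partial isomorphisms off the maximal subtree\<close>

definition nontree :: "'a set" where
  "nontree = edges G - edges T"

text \<open>A relation instead of a partial map, so that inverses become converses and words become
  relation products.\<close>

definition step :: "'a \<Rightarrow> ('x \<times> 'x) set" where
  "step a = Map.graph (edge_iso A D a)"

lemma nontree_opp: "a \<in> nontree \<Longrightarrow> opp G a \<in> nontree"
  using opp_T_iff opp_G unfolding nontree_def by blast

lemma nontree_cases:
  assumes "a \<in> nontree"
  obtains "a \<in> dorient D - edges T" | "opp G a \<in> dorient D - edges T"
  using assms orient_iff opp_T_iff unfolding nontree_def by blast

lemma step_dorient:
  assumes "a \<in> dorient D - edges T"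
  shows "step a = Map.graph (dphi D a)" "step (opp G a) = (Map.graph (dphi D a))\<inverse>"
proof -
  have a: "a \<in> edges G" "a \<notin> edges T" "a \<in> dorient D" using assms dorient_edges by auto
  show "step a = Map.graph (dphi D a)"
    using a unfolding step_def edge_iso_def Let_def by (simp flip: T_def)
  have "opp G a \<notin> edges T" "opp G a \<notin> dorient D"
    using a opp_T_iff orient_iff by auto
  then show "step (opp G a) = (Map.graph (dphi D a))\<inverse>"
    using opp_G(3)[OF a(1)] graph_inv_map[OF full_pseudogroupD(4)[OF phi[OF assms]]]
    unfolding step_def edge_iso_def Let_def by (simp flip: T_def G_def)
qed

text \<open>Tree edges are left out: there an edge and its opposite carry identities whose domains
  come from two different vertex spaces.\<close>

lemma step_opp:
  assumes "a \<in> nontree"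
  shows "step (opp G a) = (step a)\<inverse>"
  using assms
proof (rule nontree_cases)
  assume "opp G a \<in> dorient D - edges T"
  then show ?thesis
    using step_dorient[of "opp G a"] opp_G(3)[of a] assms by (auto simp: nontree_def)
qed (simp add: step_dorient)

lemma step_functional: "(x, y) \<in> step a \<Longrightarrow> (x, z) \<in> step a \<Longrightarrow> y = z"
  unfolding step_def by (auto simp: Map.graph_def)

lemma step_injective: "a \<in> nontree \<Longrightarrow> (x, z) \<in> step a \<Longrightarrow> (y, z) \<in> step a \<Longrightarrow> x = y"
  using step_opp[of a] step_functional[of z x "opp G a" y] by auto

lemma step_sub:
  assumes "a \<in> nontree"
  shows "step a \<subseteq> R"
  using assms
proof (rule nontree_cases)
  assume "a \<in> dorient D - edges T"
  then show ?thesis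
    using step_dorient full_pseudogroupD(3)[OF phi] by simp
next
  assume b: "opp G a \<in> dorient D - edges T"
  have "step (opp G a) \<subseteq> R"
    using step_dorient(1)[OF b] full_pseudogroupD(3)[OF phi[OF b]] by simp
  then have "(step a)\<inverse> \<subseteq> R" using step_opp[OF assms] by simp
  then show ?thesis by (auto intro: R_sym)
qed

section \<open>Edges crossing between translates of representative trees\<close>

text \<open>\<open>f\<close> leads from \<open>B\<^sub>x\<close> to the translate of
  \<open>B\<^sub>y\<close> by \<open>(x, y)\<close>; that its end lies in the translate is tested by
  moving it back to the fibre at \<open>y\<close>. The type of the opposite edge is recorded as
  well, since backtracking would traverse that edge.\<close>

definition crossing :: "'a \<Rightarrow> 'x \<Rightarrow> 'x \<Rightarrow> 'e \<Rightarrow> bool" where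
  "crossing a x y f \<longleftrightarrow> f \<in> fibre (esp A) x \<and> forg A f \<in> V \<and> vact A y x (fter A f) \<in> V \<and>
     f \<in> sat a \<and> fopp A f \<in> sat (opp G a)"

text \<open>The opposite edge, moved to the fibre at \<open>y\<close>, runs from
  \<open>B\<^sub>y\<close> to the translate of \<open>B\<^sub>x\<close>, and the two type conditions
  change places.\<close>

lemma crossing_reverse:
  assumes "a \<in> edges G" "(x, y) \<in> R" "crossing a x y f"
  shows "crossing (opp G a) y x (eact A y x (fopp A f))"
proof -
  have f: "f \<in> fibre (esp A) x" "forg A f \<in> V" "vact A y x (fter A f) \<in> V" "f \<in> sat a"
    "fopp A f \<in> sat (opp G a)"
    using assms(3) unfolding crossing_def by auto
  have yx: "(y, x) \<in> R" using R_sym assms(2) by blast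
  note of = end_fibre(3)[OF f(1)] and opp = opp_A[OF f(1)]
  have "forg A (eact A y x (fopp A f)) \<in> V"
    using f(3) opp end_act(1)[OF yx of] by simp
  moreover have "vact A x y (fter A (eact A y x (fopp A f))) \<in> V"
    using f(2) opp end_act(2)[OF yx of] vact_inverse[OF yx end_fibre(1)[OF f(1)]] by simp
  moreover have "fopp A (eact A y x (fopp A f)) \<in> sat (opp G (opp G a))"
    using opp end_act(3)[OF yx of] sat_act[OF f(4) yx f(1)] opp_G(3)[OF assms(1)] by simp
  ultimately show ?thesis
    unfolding crossing_def using eact_fibre[OF yx of] sat_act[OF f(5) yx of] by blast
qed

text \<open>For an edge of the orientation the value of its section is a crossing; the opposite
  edges follow by reversal.\<close>

lemma ex_crossing:
  assumes a: "a \<in> nontree" and xy: "(x, y) \<in> step a"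
  shows "\<exists>f. crossing a x y f"
proof -
  have forward: "\<exists>f. crossing b z w f"
    if b: "b \<in> dorient D - edges T" and zw: "(z, w) \<in> step b" for b z w
  proof
    have z: "dphi D b z = Some w" using zw step_dorient(1)[OF b] by (simp add: Map.graph_def)
    then have dom: "z \<in> dom (dphi D b)" by auto
    have bG: "b \<in> edges G" using b dorient_edges by auto
    have "step b \<subseteq> R" using step_sub b bG unfolding nontree_def by auto
    then have zX: "z \<in> space X" using zw R_space by blast
    note se = sect[OF b, unfolded partial_section_def]
    have "s b z \<in> space (tot (esp A))"
      using se dom zX measurable_space[of "s b" "restrict_space X (dom (dphi D b))" "tot (esp A)" z]
      by (auto simp: space_restrict_space)
    then have fib: "s b z \<in> fibre (esp A) z"
      using se dom unfolding fibre_def by blast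
    have "s b z \<in> edge_repr A D s b"
      using b dom unfolding edge_repr_def by (simp flip: T_def)
    then have 1: "s b z \<in> sat b" using sat_repr fib zX by blast
    \<comment> \<open>This selects the last branch of \<open>edge_repr\<close>, where the
      representation consists of opposites of section values.\<close>
    have "opp G b \<notin> edges T" "opp G b \<notin> dorient D"
      using b bG opp_T_iff orient_iff by auto
    then have "fopp A (s b z) \<in> edge_repr A D s (opp G b)"
      using dom opp_G(3)[OF bG] unfolding edge_repr_def Let_def by (simp flip: T_def G_def)
    then have 2: "fopp A (s b z) \<in> sat (opp G b)"
      using sat_repr end_fibre(3)[OF fib] zX by blast
    show "crossing b z w (s b z)"
      unfolding crossing_def
      using fib 1 2 sect_origin[OF b dom] sect_terminus[OF b dom] z
        vimg_V[OF opp_G(4)[OF bG]] vimg_V[OF opp_G(5)[OF bG]] by auto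
  qed
  show ?thesis
    using a
  proof (rule nontree_cases)
    assume "a \<in> dorient D - edges T"
    then show ?thesis using forward xy by blast
  next
    assume b: "opp G a \<in> dorient D - edges T"
    have aG: "a \<in> edges G" using a unfolding nontree_def by blast
    have "(y, x) \<in> step (opp G a)" using xy step_opp[OF a] by blast
    then obtain f where "crossing (opp G a) y x f" "(y, x) \<in> R"
      using forward[OF b] step_sub[OF nontree_opp[OF a]] by blast
    then show ?thesis
      using crossing_reverse[of "opp G a" y x f] opp_G(1,3)[OF aG] by auto
  qed
qed

lemma walk_act:
  assumes "(x, y) \<in> R"
  shows "walk (fibre_graph A y) u p v \<Longrightarrow> u \<in> fibre (vsp A) y \<Longrightarrow>
    walk (fibre_graph A x) (vact A x y u) (map (eact A x y) p) (vact A x y v)"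
proof (induction p arbitrary: u)
  case (Cons e p)
  then have e: "e \<in> fibre (esp A) y" by (simp add: fibre_graph_simps)
  show ?case
    using Cons end_act[OF assms e] eact_fibre[OF assms e] end_fibre[OF e]
    by (simp add: fibre_graph_simps)
qed simp

text \<open>Translation is injective on fibres and commutes with reversal, so a backtrack in the
  image would come from one in \<open>p\<close>.\<close>

lemma reduced_act:
  assumes xy: "(x, y) \<in> R" and "set p \<subseteq> fibre (esp A) y" "reduced (fopp A) p"
  shows "reduced (fopp A) (map (eact A x y) p)"
proof -
  have "f = fopp A e"
    if ef: "e \<in> fibre (esp A) y" "f \<in> fibre (esp A) y"
      "eact A x y f = fopp A (eact A x y e)" for e f
  proof -
    have "eact A x y f = eact A x y (fopp A e)"
      using ef(3) end_act(3)[OF xy ef(1)] by (rule trans)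
    then show ?thesis
      using eact_inverse[OF xy ef(2)] eact_inverse[OF xy end_fibre(3)[OF ef(1)]] by metis
  qed
  then show ?thesis
    unfolding successively_map
    by (intro successively_mono[OF assms(3)]) (use assms(2) in blast)
qed

section \<open>Words in the partial isomorphisms and their lifts\<close>

text \<open>Letters are applied from left to right. The empty word is the diagonal of the space
  only, so that words over \<open>nontree\<close> stay inside \<open>R\<close>.\<close>

primrec word :: "'a list \<Rightarrow> ('x \<times> 'x) set" where
  "word [] = Id_on (space X)"
| "word (a # w) = step a O word w"

lemma word_sub: "set w \<subseteq> nontree \<Longrightarrow> word w \<subseteq> R"
proof (induction w)
  case Nil
  then show ?case using R_equiv unfolding equiv_def refl_on_def by auto
next
  case (Cons a w)
  then show ?case using step_sub[of a] R_trans by auto blast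
qed

text \<open>The pieces of the walk lying in translates of representative trees consist of edges of the
  types in \<open>T\<close>, and the edges crossing between translates have the types of the letters of \<open>w\<close>.
  The type of the first edge is what controls backtracking when a letter is prepended.\<close>

lemma word_lift:
  assumes "(x, y) \<in> word w" "set w \<subseteq> nontree" "reduced (opp G) w"
    "u \<in> V \<inter> fibre (vsp A) x" "v \<in> V \<inter> fibre (vsp A) y"
  shows "\<exists>p. walk (fibre_graph A x) u p (vact A x y v) \<and> reduced (fopp A) p \<and>
    (w \<noteq> [] \<longrightarrow> p \<noteq> []) \<and>
    (p \<noteq> [] \<longrightarrow> (\<exists>b \<in> edges T \<union> (if w = [] then {} else {hd w}). hd p \<in> sat b))"
  using assms
proof (induction w arbitrary: x u)
  case Nil
  then have xy: "x = y" "x \<in> space X" by auto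
  then obtain p where p: "walk (rep_tree x) u p v" "reduced (fopp A) p"
    using connected_reduced_walk[of "rep_tree x" u v] rep_tree[OF xy(2)] Nil
    unfolding is_tree_def by (auto simp: rep_tree_simps)
  have "\<exists>b\<in>edges T. hd p \<in> sat b" if "p \<noteq> []"
  proof -
    have "hd p \<in> edges (rep_tree x)" using walk_edges[OF p(1)] that by auto
    then show ?thesis using E_sat[of "hd p" x] xy by (auto simp: rep_tree_simps)
  qed
  moreover have "vact A x y v = v" using vact_id Nil xy by auto
  ultimately show ?case using walk_rep_tree[OF p(1)] p(2) by auto
next
  case (Cons a w)
  then obtain z where z: "(x, z) \<in> step a" "(z, y) \<in> word w" by auto
  have a: "a \<in> nontree" and w: "set w \<subseteq> nontree" using Cons.prems by auto
  have aG: "a \<in> edges G" "a \<notin> edges T" using a unfolding nontree_def by auto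
  have xz: "(x, z) \<in> R" using step_sub a z by blast
  have zy: "(z, y) \<in> R" using word_sub w z by blast
  have zx: "(z, x) \<in> R" using R_sym xz by blast
  have xX: "x \<in> space X" using R_space xz by blast
  \<comment> \<open>The walk will be \<open>g @ f # r\<close>: \<open>g\<close> stays in
    \<open>B\<^sub>x\<close> up to the origin of the crossing edge \<open>f\<close>, and
    \<open>r\<close> is the translate of the walk \<open>q\<close> that the shorter word gives in
    the fibre at \<open>z\<close>.\<close>
  obtain f where "crossing a x z f" using ex_crossing a z by blast
  then have f: "f \<in> fibre (esp A) x" "forg A f \<in> V" "vact A z x (fter A f) \<in> V" "f \<in> sat a"
    "fopp A f \<in> sat (opp G a)"
    unfolding crossing_def by auto
  have tf: "vact A z x (fter A f) \<in> V \<inter> fibre (vsp A) z"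
    using f vact_fibre zx end_fibre by auto
  have "reduced (opp G) w" using Cons.prems(3) by (auto simp: successively_Cons)
  then obtain q where q: "walk (fibre_graph A z) (vact A z x (fter A f)) q (vact A z y v)"
    "reduced (fopp A) q"
    "q \<noteq> [] \<Longrightarrow> \<exists>b \<in> edges T \<union> (if w = [] then {} else {hd w}). hd q \<in> sat b"
    using Cons.IH[OF z(2) w _ tf Cons.prems(5)] by blast
  define r where "r = map (eact A x z) q"
  have q_fib: "set q \<subseteq> fibre (esp A) z"
    using walk_edges[OF q(1)] by (simp add: fibre_graph_simps)
  have "walk (fibre_graph A x) (vact A x z (vact A z x (fter A f))) r (vact A x z (vact A z y v))"
    unfolding r_def using walk_act[OF xz q(1)] tf by blast
  then have r1: "walk (fibre_graph A x) (fter A f) r (vact A x y v)"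
    using vact_inverse[OF zx] end_fibre(2)[OF f(1)] vact_vact[OF xz zy] Cons.prems(5) by simp
  have r2: "reduced (fopp A) r"
    unfolding r_def by (rule reduced_act[OF xz q_fib q(2)])
  \<comment> \<open>Otherwise the first edge of \<open>r\<close> would have type
    \<open>opp G a\<close>. But types are invariant and the first edge of \<open>q\<close> has a
    type in \<open>T\<close> or type \<open>hd w\<close>; \<open>opp G a\<close> is outside
    \<open>T\<close>, and it differs from \<open>hd w\<close> as \<open>a # w\<close> is
    reduced.\<close>
  have r3: "hd r \<noteq> fopp A f" if "r \<noteq> []"
  proof
    assume eq: "hd r = fopp A f"
    have qn: "q \<noteq> []" using that r_def by simp
    then obtain b where b: "b \<in> edges T \<union> (if w = [] then {} else {hd w})" "hd q \<in> sat b"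
      using q(3) by blast
    have "hd q \<in> fibre (esp A) z" using qn q_fib by auto
    then have "hd r \<in> sat b" using sat_act[OF b(2) xz] qn by (simp add: r_def hd_map)
    moreover have "b \<in> edges G"
      using b(1) w edges_T unfolding nontree_def by (cases w) auto
    ultimately have "b = opp G a"
      using sat_disjoint[of b "opp G a" "hd r"] eq f(5) opp_G(1)[OF aG(1)] by auto
    then show False
      using b(1) opp_T_iff[OF aG(1)] aG(2) Cons.prems(3)
      by (auto simp: successively_Cons split: if_splits)
  qed
  have "forg A f \<in> V \<inter> fibre (vsp A) x" using f end_fibre by blast
  then obtain g where g: "walk (rep_tree x) u g (forg A f)" "reduced (fopp A) g"
    using connected_reduced_walk[of "rep_tree x" u "forg A f"] rep_tree[OF xX] Cons.prems(4)
    unfolding is_tree_def by (auto simp: rep_tree_simps)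
  have g_sat: "\<exists>b\<in>edges T. e \<in> sat b" if "e \<in> edges (rep_tree x)" for e
    using E_sat[of e x] xX that by (auto simp: rep_tree_simps)
  \<comment> \<open>A representative tree is closed under opposites, so a backtrack here would put
    \<open>f\<close> into it and give \<open>f\<close> a type in \<open>T\<close>.\<close>
  have g3: "f \<noteq> fopp A (last g)" if "g \<noteq> []"
  proof
    assume eq: "f = fopp A (last g)"
    have "last g \<in> edges (rep_tree x)" using walk_edges[OF g(1)] that by auto
    then have "opp (rep_tree x) (last g) \<in> edges (rep_tree x)"
      using rep_tree[OF xX] unfolding is_tree_def serre_graph_def by blast
    then obtain b where "b \<in> edges T" "f \<in> sat b"
      using g_sat eq by (auto simp: rep_tree_simps(5))
    then show False using sat_disjoint[of b a f] f(4) aG edges_T by auto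
  qed
  have "walk (fibre_graph A x) u (g @ f # r) (vact A x y v)"
    using walk_rep_tree[OF g(1)] r1 f(1) by (auto simp: walk_append fibre_graph_simps)
  moreover have "reduced (fopp A) (g @ f # r)"
    using g(2) g3 r2 r3 by (auto simp: successively_append_iff successively_Cons)
  moreover have "\<exists>b \<in> edges T \<union> {a}. hd (g @ f # r) \<in> sat b"
  proof (cases g)
    case Nil
    then show ?thesis using f(4) by auto
  next
    case (Cons e g')
    then show ?thesis using g_sat[of e] walk_edges[OF g(1)] by auto
  qed
  ultimately show ?case by (intro exI[of _ "g @ f # r"]) simp
qed

text \<open>A vertex common to \<open>B\<^sub>x\<close> and the translate of
  \<open>B\<^sub>y\<close> can serve as both ends of the lifted walk. A closed reduced walk in a
  tree is empty, while a nonempty word lifts to a nonempty walk.\<close>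

lemma word_disjoint:
  assumes "(x, y) \<in> word w" "set w \<subseteq> nontree" "reduced (opp G) w"
    "v \<in> V \<inter> fibre (vsp A) y" "vact A x y v \<in> V"
  shows "w = []"
proof -
  have xy: "(x, y) \<in> R" using word_sub assms by blast
  then have "vact A x y v \<in> V \<inter> fibre (vsp A) x" using assms vact_fibre by blast
  then obtain p where p: "walk (fibre_graph A x) (vact A x y v) p (vact A x y v)"
    "reduced (fopp A) p" "w \<noteq> [] \<longrightarrow> p \<noteq> []"
    using word_lift[OF assms(1-3) _ assms(4)] by blast
  have "is_tree (fibre_graph A x)"
    using arb R_space[OF xy] unfolding arboretum_def by blast
  then have "p = []"
    using is_tree_closed_reduced_walk p by (metis fibre_graph_simps(5))
  then show ?thesis using p(3) by blast
qed

text \<open>Any vertex of \<open>B\<^sub>x\<close> is its own translate under \<open>(x, x)\<close>,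
  so a nonempty reduced word has no fixed point.\<close>

lemma closed_word:
  assumes "(x, x) \<in> word w" "set w \<subseteq> nontree" "reduced (opp G) w"
  shows "w = []"
proof -
  have xX: "x \<in> space X" using word_sub assms R_space by blast
  obtain v where v: "v \<in> V \<inter> fibre (vsp A) x"
    using rep_tree[OF xX] unfolding is_tree_def connected_graph_def by (auto simp: rep_tree_simps)
  then have "vact A x x v = v" using vact_id xX by blast
  then show ?thesis using word_disjoint[OF assms v] v by auto
qed


section \<open>The relation generated by the \<open>\<phi>\<^sub>a\<close>\<close>

text \<open>The graph that turns out to be the treeing.\<close>

definition forest :: "('x \<times> 'x) set" where
  "forest = (\<Union>a\<in>nontree. step a)"

lemma sym_forest: "sym forest"
  unfolding forest_def using step_opp nontree_opp by (blast intro: symI)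

lemma word_append_step:
  "(x, y) \<in> word w \<Longrightarrow> (y, z) \<in> step a \<Longrightarrow> z \<in> space X \<Longrightarrow> (x, z) \<in> word (w @ [a])"
  by (induction w arbitrary: x) auto

text \<open>Words spell out paths. The condition on \<open>x\<close> is there because the closure is
  reflexive on the whole type, the empty word only on the space.\<close>

lemma forest_rtrancl: "(x, y) \<in> forest\<^sup>* \<and> x \<in> space X \<longleftrightarrow> (\<exists>w\<in>lists nontree. (x, y) \<in> word w)"
proof
  have "(x, y) \<in> forest\<^sup>* \<Longrightarrow> x \<in> space X \<Longrightarrow> \<exists>w\<in>lists nontree. (x, y) \<in> word w"
  proof (induction rule: converse_rtrancl_induct)
    case base
    then have "(y, y) \<in> word []" by auto
    then show ?case by blast
  next
    case (step x z)
    then obtain a where a: "a \<in> nontree" "(x, z) \<in> step a" unfolding forest_def by blast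
    moreover have "z \<in> space X" using a step_sub R_space by blast
    then obtain w where "w \<in> lists nontree" "(z, y) \<in> word w" using step.IH by blast
    ultimately have "(x, y) \<in> word (a # w)" "a # w \<in> lists nontree" by auto
    then show ?case by blast
  qed
  then show "(x, y) \<in> forest\<^sup>* \<and> x \<in> space X \<Longrightarrow> \<exists>w\<in>lists nontree. (x, y) \<in> word w" by blast
next
  assume "\<exists>w\<in>lists nontree. (x, y) \<in> word w"
  then obtain w where w: "set w \<subseteq> nontree" "(x, y) \<in> word w" by auto
  have "(x, y) \<in> forest\<^sup>*"
    using w
  proof (induction w arbitrary: x)
    case (Cons a w)
    then obtain z where "(x, z) \<in> step a" "(z, y) \<in> word w" by auto
    then show ?case
      using Cons unfolding forest_def by (intro converse_rtrancl_into_rtrancl[of x z]) auto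
  qed auto
  then show "(x, y) \<in> forest\<^sup>* \<and> x \<in> space X" using word_sub w R_space by blast
qed

text \<open>A letter followed by its opposite leads back to the starting point, since
  \<open>step a\<close> is injective; such a pair is dropped.\<close>

lemma reduced_word:
  assumes "(x, y) \<in> word w" "set w \<subseteq> nontree"
  shows "\<exists>w'. (x, y) \<in> word w' \<and> set w' \<subseteq> nontree \<and> reduced (opp G) w'"
  using assms
proof (induction w arbitrary: x)
  case Nil
  then show ?case by (intro exI[of _ "[]"]) simp
next
  case (Cons a w)
  then obtain z where z: "(x, z) \<in> step a" "(z, y) \<in> word w" by auto
  then obtain w' where w': "(z, y) \<in> word w'" "set w' \<subseteq> nontree" "reduced (opp G) w'"
    using Cons.IH[OF z(2)] Cons.prems(2) by auto
  have a: "a \<in> nontree" using Cons.prems by auto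
  show ?case
  proof (cases "w' = [] \<or> hd w' \<noteq> opp G a")
    case True
    then have "(x, y) \<in> word (a # w') \<and> set (a # w') \<subseteq> nontree \<and> reduced (opp G) (a # w')"
      using z w' a by (auto simp: successively_Cons)
    then show ?thesis by blast
  next
    case False
    then obtain w'' where w'': "w' = opp G a # w''" by (cases w') auto
    then obtain x' where x': "(z, x') \<in> step (opp G a)" "(x', y) \<in> word w''" using w' by auto
    then have "(x', z) \<in> step a" using step_opp[OF a] by blast
    then have "x' = x" using step_injective[OF a] z by blast
    then have "(x, y) \<in> word w'' \<and> set w'' \<subseteq> nontree \<and> reduced (opp G) w''"
      using x' w' w'' by (auto simp: successively_Cons)
    then show ?thesis by blast
  qed
qed

text \<open>Tree edges carry restricted identities, hence contribute nothing to the generated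
  relation.\<close>

lemma tree_step_Id:
  assumes "a \<in> edges T"
  shows "step a \<subseteq> Id_on (space X)"
proof -
  let ?P = "origin G a"
  have P: "?P \<in> verts G" using assms edges_T opp_G by blast
  have "prj (vsp A) ` V \<subseteq> space X"
    using sub_arb unfolding sub_arboretum_def by blast
  then have "prj (vsp A) ` vimg (dgraph D) (drep D) ?P \<subseteq> space X"
    using vimg_V[OF P] by blast
  then show ?thesis
    using assms unfolding step_def edge_iso_def Let_def
    by (auto simp: Map.graph_def restrict_map_def image_subset_iff simp flip: T_def G_def split: if_splits)
qed

lemma forest_equiv: "equiv (space X) {(x, y). x \<in> space X \<and> (x, y) \<in> forest\<^sup>*}"
  (is "equiv _ ?K")
proof (rule equivI)
  have "?K \<subseteq> R"
  proof safe
    fix x y assume "(x, y) \<in> forest\<^sup>*" "x \<in> space X"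
    then obtain w where "w \<in> lists nontree" "(x, y) \<in> word w" using forest_rtrancl by blast
    then show "(x, y) \<in> R" using word_sub[of w] by auto
  qed
  then show sp: "?K \<subseteq> space X \<times> space X" using R_space by blast
  show "refl_on (space X) ?K" by (auto simp: refl_on_def)
  show "sym ?K"
  proof (rule symI)
    fix x y assume xy: "(x, y) \<in> ?K"
    then have "y \<in> space X" using sp by blast
    then show "(y, x) \<in> ?K" using xy sym_rtrancl[OF sym_forest] by (auto dest: symD)
  qed
  show "trans ?K" by (auto simp: trans_def)
qed

text \<open>Reachability in the forest is an equivalence containing all generators, and every
  equivalence on the space containing them contains the forest paths.\<close>

lemma edge_subrelation_eq: "edge_subrelation X A D = {(x, y). x \<in> space X \<and> (x, y) \<in> forest\<^sup>*}"
proof -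
  let ?K = "{(x, y). x \<in> space X \<and> (x, y) \<in> forest\<^sup>*}"
  let ?S = "\<Union>a\<in>edges G. step a"
  have "?S \<subseteq> ?K"
  proof safe
    fix a x y assume a: "a \<in> edges G" and xy: "(x, y) \<in> step a"
    have "x \<in> space X \<and> (x, y) \<in> forest\<^sup>*"
    proof (cases "a \<in> edges T")
      case True
      then show ?thesis using tree_step_Id xy by auto
    next
      case False
      then have "a \<in> nontree" using a unfolding nontree_def by blast
      then show ?thesis using xy step_sub R_space unfolding forest_def by blast
    qed
    then show "x \<in> space X" "(x, y) \<in> forest\<^sup>*" by auto
  qed
  moreover have "?K \<subseteq> Q" if Q: "equiv (space X) Q" "?S \<subseteq> Q" for Q
  proof safe
    fix x y assume "(x, y) \<in> forest\<^sup>*" "x \<in> space X"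
    then show "(x, y) \<in> Q"
    proof (induction rule: rtrancl_induct)
      case base
      then show ?case using Q(1) unfolding equiv_def refl_on_def by blast
    next
      case (step y z)
      then have "(y, z) \<in> Q" using Q(2) unfolding forest_def nontree_def by blast
      then show ?case using step Q(1) unfolding equiv_def trans_def by blast
    qed
  qed
  ultimately show ?thesis
    using forest_equiv unfolding edge_subrelation_def generated_equiv_def step_def G_def by blast
qed

lemma edge_subrelation_word: "edge_subrelation X A D = (\<Union>w\<in>lists nontree. word w)"
  unfolding edge_subrelation_eq using forest_rtrancl by blast

section \<open>Borelness of the forest and of the generated relation\<close>

lemma step_relcomp_sets:
  assumes a: "a \<in> nontree" and S: "S \<in> sets (X \<Otimes>\<^sub>M X)"
  shows "step a O S \<in> sets (X \<Otimes>\<^sub>M X)"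
  using a
proof (rule nontree_cases)
  assume "a \<in> dorient D - edges T"
  then show ?thesis
    using sets_relcomp_partial_map[OF full_pseudogroupD(1,5)[OF phi] S] step_dorient(1) by simp
next
  assume b: "opp G a \<in> dorient D - edges T"
  note fp = full_pseudogroupD[OF phi[OF b]]
  have "opp G (opp G a) = a" using a opp_G(3) unfolding nontree_def by blast
  then have "step a = Map.graph (inv_map (dphi D (opp G a)))"
    using step_dorient(2)[OF b] graph_inv_map[OF fp(4)] by simp
  then show ?thesis
    using sets_relcomp_partial_map[of "inv_map (dphi D (opp G a))" X S] fp S by (simp add: dom_inv_map)
qed

lemma word_sets: "w \<in> lists nontree \<Longrightarrow> word w \<in> sets (X \<Otimes>\<^sub>M X)"
  by (induction w) (auto intro: step_relcomp_sets standard_borel_diagonal[OF std])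

lemma countable_nontree: "countable nontree"
  using countable_edges_G unfolding nontree_def by (rule countable_subset[rotated]) blast

lemma forest_sets: "forest \<in> sets (X \<Otimes>\<^sub>M X)"
proof -
  have "step a \<in> sets (X \<Otimes>\<^sub>M X)" if a: "a \<in> nontree" for a
  proof -
    \<comment> \<open>Composing with the diagonal brings \<open>step a\<close> into the form covered
      by \<open>step_relcomp_sets\<close>.\<close>
    have "step a O Id_on (space X) = step a"
      using step_sub[OF a] R_space by auto
    then show ?thesis
      using step_relcomp_sets[OF a standard_borel_diagonal[OF std]] by simp
  qed
  then show ?thesis
    unfolding forest_def using countable_nontree by (intro sets.countable_UN') auto
qed

text \<open>Words are Borel and there are countably many; the classes lie in classes of
  \<open>R\<close>.\<close>

lemma edge_subrelation_countable_borel: "countable_borel_equiv X (edge_subrelation X A D)"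
proof -
  have "edge_subrelation X A D \<in> sets (X \<Otimes>\<^sub>M X)"
    unfolding edge_subrelation_word
    using countable_nontree word_sets by (intro sets.countable_UN') auto
  moreover have "countable (edge_subrelation X A D `` {x})" if "x \<in> space X" for x
  proof (rule countable_subset)
    show "edge_subrelation X A D `` {x} \<subseteq> R `` {x}"
      unfolding edge_subrelation_word using word_sub by auto
    show "countable (R `` {x})"
      using cbe that unfolding countable_borel_equiv_def by blast
  qed
  ultimately show ?thesis
    using forest_equiv edge_subrelation_eq unfolding countable_borel_equiv_def borel_equiv_def by simp
qed

section \<open>The forest is a treeing\<close>

lemma irrefl_forest: "irrefl forest"
proof (rule irreflI)
  fix x
  show "(x, x) \<notin> forest"
  proof
    assume "(x, x) \<in> forest"
    then obtain a where a: "a \<in> nontree" "(x, x) \<in> step a" unfolding forest_def by blast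
    then have "(x, x) \<in> word [a]" using step_sub R_space by fastforce
    then show False using closed_word[of x "[a]"] a by simp
  qed
qed

text \<open>A cycle spells a nonempty reduced word that fixes its first vertex, contrary to
  \<open>closed_word\<close>.\<close>

lemma acyclic_forest: "acyclic_graph_rel forest"
  unfolding acyclic_graph_rel_def
proof (intro notI, elim exE conjE)
  fix p :: "'x list"
  let ?n = "length p"
  assume n: "3 \<le> ?n" and dist: "distinct p"
    and edge: "\<forall>i<?n. (p ! i, p ! (Suc i mod ?n)) \<in> forest"
  \<comment> \<open>Indices modulo the length make \<open>q\<close> periodic, so the closing edge of
    the cycle is no special case.\<close>
  define q where "q i = p ! (i mod ?n)" for i
  have "\<exists>a. a \<in> nontree \<and> (q i, q (Suc i)) \<in> step a" for i
  proof -
    have "i mod ?n < ?n" using n by (intro mod_less_divisor) linarith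
    then have "(p ! (i mod ?n), p ! (Suc (i mod ?n) mod ?n)) \<in> forest" using edge by blast
    then show ?thesis unfolding q_def forest_def by (auto simp: mod_Suc_eq)
  qed
  then obtain a where a: "\<And>i. a i \<in> nontree" "\<And>i. (q i, q (Suc i)) \<in> step (a i)" by metis
  \<comment> \<open>A letter followed by its opposite gives \<open>q (Suc (Suc i)) = q i\<close>. At
    least three distinct vertices exclude this, also when \<open>Suc (Suc i) = ?n\<close> and
    \<open>q\<close> wraps around.\<close>
  have red: "a (Suc i) \<noteq> opp G (a i)" if i: "Suc i < ?n" for i
  proof
    assume "a (Suc i) = opp G (a i)"
    then have "(q (Suc (Suc i)), q (Suc i)) \<in> step (a i)"
      using a(2)[of "Suc i"] step_opp[OF a(1)[of i]] by auto
    then have "q (Suc (Suc i)) = q i" using step_injective a by blast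
    moreover have "i mod ?n = i" "Suc (Suc i) mod ?n \<noteq> i" "Suc (Suc i) mod ?n < ?n"
      using i n by (auto simp: mod_Suc)
    ultimately show False
      using nth_eq_iff_index_eq[OF dist, of "Suc (Suc i) mod ?n" i] i unfolding q_def by auto
  qed
  have word: "(q i, q j) \<in> word (map a [i..<j])" if "i \<le> j" for i j
    using that
  proof (induction j rule: dec_induct)
    case base
    have "q i \<in> space X" using a step_sub R_space by blast
    then show ?case by (simp add: Id_onI)
  next
    case (step j)
    have "q (Suc j) \<in> space X" using a step_sub R_space by blast
    then show ?case using word_append_step[OF step.IH a(2)] step by simp
  qed
  have "reduced (opp G) (map a [0..<m])" if "m \<le> ?n" for m
    using that
  proof (induction m)
    case (Suc m)
    then show ?case using red[of "m - 1"]
      by (cases m) (auto simp: successively_append_iff)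
  qed simp
  moreover have "q ?n = q 0" unfolding q_def by simp
  moreover have "set (map a [0..<?n]) \<subseteq> nontree" using a by auto
  ultimately have "map a [0..<?n] = []" using closed_word word[of 0 ?n] by (metis order_refl zero_le)
  then show False using n by simp
qed

lemma edge_subrelation_arborable: "arborable X (edge_subrelation X A D)"
proof -
  have "forest\<^sup>* `` {x} = edge_subrelation X A D `` {x}" if "x \<in> space X" for x
    using that unfolding edge_subrelation_eq by auto
  then show ?thesis
    unfolding arborable_def
    using edge_subrelation_countable_borel forest_sets sym_forest irrefl_forest acyclic_forest by blast
qed

section \<open>The relations carried by the vertices\<close>

text \<open>Points related by \<open>R\<^sub>P\<close> carry vertices of
  \<open>\<chi>(X\<^sub>P)\<close> in one orbit, so \<open>B\<^sub>x\<close> meets the translate of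
  \<open>B\<^sub>y\<close>.\<close>

lemma vertex_relation_lift:
  assumes P: "P \<in> verts G" and "(x, y) \<in> vertex_relation A D P"
  shows "\<exists>v. v \<in> V \<inter> fibre (vsp A) y \<and> vact A x y v \<in> V"
proof -
  let ?r = "\<lambda>u. rvert (drep D) (P, u)"
  obtain u u' where u: "(u, u') \<in> vrel (dgraph D) P" "x = prj (vsp A) (?r u)" "y = prj (vsp A) (?r u')"
    using assms(2) unfolding vertex_relation_def rel_image_def ident_def by auto
  have "rel_image ?r (vrel (dgraph D) P) = Restr (vorbit R A) (vimg (dgraph D) (drep D) P)"
    using reps P verts_T
    unfolding arboretum_of_representatives_def representation_def vimg_def by simp
  then have "(?r u, ?r u') \<in> Restr (vorbit R A) (vimg (dgraph D) (drep D) P)"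
    using u(1) unfolding rel_image_def by force
  then show ?thesis
    using vimg_V[OF P] u by (intro exI[of _ "?r u'"]) (auto simp: orbit_rel_def fibre_def)
qed

text \<open>A reduced word from \<open>x\<close> to \<open>y\<close> is empty, because the trees
  that it would make disjoint share a vertex.\<close>

lemma vertex_relation_trivial:
  assumes "P \<in> verts G"
  shows "trivial_rel (vertex_relation A D P \<inter> edge_subrelation X A D)"
  unfolding trivial_rel_def
proof safe
  fix x y assume v: "(x, y) \<in> vertex_relation A D P" and e: "(x, y) \<in> edge_subrelation X A D"
  obtain w where w: "(x, y) \<in> word w" "set w \<subseteq> nontree" "reduced (opp G) w"
    using e reduced_word unfolding edge_subrelation_word by blast
  then have "w = []" using word_disjoint vertex_relation_lift[OF assms v] by blast
  then show "x = y" using w by auto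
qed

end

theorem proposition38:
  fixes X :: "'x measure"
    and R :: "('x \<times> 'x) set"
    and A :: "('x, 'v, 'e) graph_field_act"
    and D :: "('x, 'v, 'e, 'p, 'a, 'u, 'w) desing"
  assumes "standard_borel X"
    and "countable_borel_equiv X R"
    and "arboretum X R A"
    and "desingularization X R A D"
  shows "(\<forall>P \<in> verts (ugraph (dgraph D)).
            trivial_rel (vertex_relation A D P \<inter> edge_subrelation X A D)) \<and>
         arborable X (edge_subrelation X A D)"
proof -
  note d = assms(4)[unfolded desingularization_def Let_def]
  \<comment> \<open>One family of sections serves both the crossing conditions and the partition of
    the edges.\<close>
  obtain s where s: "\<forall>a\<in>dorient D - edges (dtree D).
      partial_section X (esp A) (dom (dphi D a)) (s a) \<and>
      (\<forall>x\<in>dom (dphi D a).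
         forg A (s a x) \<in> vimg (dgraph D) (drep D) (origin (ugraph (dgraph D)) a) \<and>
         vact A (the (dphi D a x)) x (fter A (s a x))
           \<in> vimg (dgraph D) (drep D) (terminus (ugraph (dgraph D)) a))"
    "indexed_partition (edges (ugraph (dgraph D))) (\<lambda>a. eorbit R A `` edge_repr A D s a)
      (space (tot (esp A)))"
    using d by fast
  interpret desingularized X R A D s "ugraph (dgraph D)" "dtree D"
    by unfold_locales (use assms(1-3) d s in blast)+
  show ?thesis
    using vertex_relation_trivial edge_subrelation_arborable by blast
qed

end
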